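(* Let $G=\langle S\mid R\rangle$ be a finite group presentation satisfying the $C''(4)$-$T(4)$ or the $C''(3)$-$T(6)$ small cancellation condition, and let $X=S\cup S^{-1}$. Then for every $g\in G$ the number $\tau_X(g)$ is rational and, moreover, $2\tau_X(g)$ is an integer. Moreover, for every nontrivial element $g\in G$ the element $g^2$ is conjugate to a periodically geodesic element $h$, that is, an element $h$ such that $l_X(h^n)=|n|\,l_X(h)$ for each $n\in\mathbb{Z}$. Also, the set of all $d_X$-geodesic words is a regular language over the alphabet $X$.
   Context: $l_X(g)$ denotes the minimal $n$ such that $g$ is a product of $n$ elements of $X$; $\tau_X(g)=\lim_{n\to\infty} l_X(g^n)/n$ (the limit always exists). The word metric is $d_X(g,h)=l_X(h^{-1}g)$. A word $x_1\dots x_k$ with $x_i\in X$ is $d_X$-geodesic if the element of $G$ it represents has $l_X$ equal to $k$. Small cancellation conditions. $G=\langle S\mid R\rangle$ is a presentation with $S$, $R$ finite, where $R$ is a set of nonempty cyclically reduced words in the free group $F(S)$ closed under taking cyclic permutations and inverses. A nonempty word $u$ is a piece if there are two distinct relators $r_1,r_2\in R$ both having $u$ as an initial segment. $C(p)$: no relator in $R$ is a product of fewer than $p$ pieces. $T(q)$: for any $3\le k<q$ and any sequence $r_1,\dots,r_k\in R$ with $r_i\ne r_{i+1}^{-1}$ for all $i$ (indices mod $k$), at least one of the words $r_ir_{i+1}$ (indices mod $k$) is reduced as written (no cancellation at the junction). $P$: all pieces have length one and no relator in $R$ is a proper power. $C''(p)$: conditions $C(p)$ and $P$ hold and all relators in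 $R$ have length $p$. $C''(p)$-$T(q)$ means both $C''(p)$ and $T(q)$ hold. *)

theory Defs
  imports Complex_Main "HOL-Algebra.Group" "HOL-Library.Sublist"
begin

section \<open>Words in a free group\<close>

text \<open>A letter \<open>(s, True)\<close> stands for the generator \<open>s\<close>, and \<open>(s, False)\<close> for its formal inverse.\<close>

type_synonym 'a letter = "'a \<times> bool"
type_synonym 'a word = "'a letter list"

definition linv :: "'a letter \<Rightarrow> 'a letter" where
  "linv x = (fst x, \<not> snd x)"

definition winv :: "'a word \<Rightarrow> 'a word" where
  "winv w = rev (map linv w)"

definition words :: "'a set \<Rightarrow> 'a word set" where
  "words S = lists (S \<times> UNIV)"

definition reduced :: "'a word \<Rightarrow> bool" where
  "reduced w \<longleftrightarrow> (\<forall>i. Suc i < length w \<longrightarrow> w ! Suc i \<noteq> linv (w ! i))"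

definition cyclically_reduced :: "'a word \<Rightarrow> bool" where
  "cyclically_reduced w \<longleftrightarrow> reduced w \<and> (w \<noteq> [] \<longrightarrow> hd w \<noteq> linv (last w))"

text \<open>A presentation \<open>\<langle>S | R\<rangle>\<close> with a finite set of generators and a finite symmetrized set of
  relators.\<close>

definition finite_symmetrized_presentation :: "'a set \<Rightarrow> 'a word set \<Rightarrow> bool" where
  "finite_symmetrized_presentation S R \<longleftrightarrow>
     finite S \<and> finite R \<and> R \<subseteq> words S \<and>
     (\<forall>r\<in>R. r \<noteq> [] \<and> cyclically_reduced r) \<and>
     (\<forall>r\<in>R. \<forall>k. rotate k r \<in> R) \<and>
     (\<forall>r\<in>R. winv r \<in> R)"

section \<open>Small cancellation conditions\<close>

definition piece :: "'a word set \<Rightarrow> 'a word \<Rightarrow> bool" where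
  "piece R u \<longleftrightarrow> u \<noteq> [] \<and> (\<exists>r1\<in>R. \<exists>r2\<in>R. r1 \<noteq> r2 \<and> prefix u r1 \<and> prefix u r2)"

definition cond_C :: "'a word set \<Rightarrow> nat \<Rightarrow> bool" where
  "cond_C R p \<longleftrightarrow>
     (\<forall>r\<in>R. \<not> (\<exists>us. length us < p \<and> (\<forall>u\<in>set us. piece R u) \<and> r = concat us))"

definition cond_T :: "'a word set \<Rightarrow> nat \<Rightarrow> bool" where
  "cond_T R q \<longleftrightarrow>
     (\<forall>k r. 3 \<le> k \<and> k < q \<and> (\<forall>i<k. r i \<in> R) \<and> (\<forall>i<k. r i \<noteq> winv (r (Suc i mod k))) \<longrightarrow>
        (\<exists>i<k. reduced (r i @ r (Suc i mod k))))"

text \<open>Since it is only applied to cyclically reduced words, being a proper power in the free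
  group amounts to being a proper power without cancellation.\<close>

definition proper_power :: "'a word \<Rightarrow> bool" where
  "proper_power r \<longleftrightarrow> (\<exists>w n. 2 \<le> n \<and> r = concat (replicate n w))"

definition cond_P :: "'a word set \<Rightarrow> bool" where
  "cond_P R \<longleftrightarrow> (\<forall>u. piece R u \<longrightarrow> length u = 1) \<and> (\<forall>r\<in>R. \<not> proper_power r)"

definition cond_C'' :: "'a word set \<Rightarrow> nat \<Rightarrow> bool" where
  "cond_C'' R p \<longleftrightarrow> cond_C R p \<and> cond_P R \<and> (\<forall>r\<in>R. length r = p)"

definition cond_C''_T :: "'a word set \<Rightarrow> nat \<Rightarrow> nat \<Rightarrow> bool" where
  "cond_C''_T R p q \<longleftrightarrow> cond_C'' R p \<and> cond_T R q"

section \<open>The presented group\<close>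

text \<open>Two words over the generators and their inverses represent the same element of
  \<open>\<langle>S | R\<rangle>\<close> iff they are related by insertions and deletions of subwords \<open>x x\<^sup>-\<^sup>1\<close> and of relators.
  The group consists of the classes of this relation.\<close>

inductive pres_eq :: "'a set \<Rightarrow> 'a word set \<Rightarrow> 'a word \<Rightarrow> 'a word \<Rightarrow> bool" for S R where
  refl: "u \<in> words S \<Longrightarrow> pres_eq S R u u"
| sym: "pres_eq S R u v \<Longrightarrow> pres_eq S R v u"
| trans: "pres_eq S R u v \<Longrightarrow> pres_eq S R v w \<Longrightarrow> pres_eq S R u w"
| cancel: "u \<in> words S \<Longrightarrow> v \<in> words S \<Longrightarrow> x \<in> S \<times> UNIV \<Longrightarrow>
    pres_eq S R (u @ [x, linv x] @ v) (u @ v)"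
| relator: "u \<in> words S \<Longrightarrow> v \<in> words S \<Longrightarrow> r \<in> R \<Longrightarrow> r \<in> words S \<Longrightarrow>
    pres_eq S R (u @ r @ v) (u @ v)"

definition pres_class :: "'a set \<Rightarrow> 'a word set \<Rightarrow> 'a word \<Rightarrow> 'a word set" where
  "pres_class S R u = {v. pres_eq S R u v}"

definition presented_group :: "'a set \<Rightarrow> 'a word set \<Rightarrow> 'a word set monoid" where
  "presented_group S R =
     \<lparr>carrier = pres_class S R ` words S,
      mult = (\<lambda>A B. {w. \<exists>u\<in>A. \<exists>v\<in>B. pres_eq S R (u @ v) w}),
      one = pres_class S R []\<rparr>"

definition pres_gen :: "'a set \<Rightarrow> 'a word set \<Rightarrow> 'a \<Rightarrow> 'a word set" where
  "pres_gen S R s = pres_class S R [(s, True)]"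

definition pres_X :: "'a set \<Rightarrow> 'a word set \<Rightarrow> 'a word set set" where
  "pres_X S R = pres_gen S R ` S \<union> m_inv (presented_group S R) ` pres_gen S R ` S"

lemma words_append [simp]: "u @ v \<in> words S \<longleftrightarrow> u \<in> words S \<and> v \<in> words S"
  by (auto simp: words_def)

lemma words_Nil [simp]: "[] \<in> words S"
  by (auto simp: words_def)

lemma words_winv [simp]: "u \<in> words S \<Longrightarrow> winv u \<in> words S"
  by (auto simp: words_def winv_def linv_def in_lists_conv_set dest!: bspec)

lemma pres_eq_words: "pres_eq S R u v \<Longrightarrow> u \<in> words S \<and> v \<in> words S"
  by (induction rule: pres_eq.induct) (auto simp: words_def linv_def)

lemma pres_eq_append_both:
  "pres_eq S R u v \<Longrightarrow> a \<in> words S \<Longrightarrow> b \<in> words S \<Longrightarrow> pres_eq S R (a @ u @ b) (a @ v @ b)"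
proof (induction rule: pres_eq.induct)
  case (cancel u v x)
  then show ?case using pres_eq.cancel[of "a @ u" S "v @ b" x R] by simp
next
  case (relator u v r)
  then show ?case using pres_eq.relator[of "a @ u" S "v @ b" r R] by simp
qed (auto intro: pres_eq.intros)

lemma pres_eq_append:
  assumes "pres_eq S R u u'" "pres_eq S R v v'"
  shows "pres_eq S R (u @ v) (u' @ v')"
proof -
  have "pres_eq S R (u @ v) (u' @ v)"
    using pres_eq_append_both[OF assms(1), of "[]" v] pres_eq_words[OF assms(2)] by simp
  moreover have "pres_eq S R (u' @ v) (u' @ v')"
    using pres_eq_append_both[OF assms(2), of "u'" "[]"] pres_eq_words[OF assms(1)] by simp
  ultimately show ?thesis by (rule pres_eq.trans)
qed

lemma pres_class_eq_iff:
  assumes "u \<in> words S"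
  shows "pres_class S R u = pres_class S R v \<longleftrightarrow> pres_eq S R u v"
  using assms unfolding pres_class_def
  by (auto intro: pres_eq.intros dest: pres_eq_words)

lemma pres_class_mult:
  assumes "u \<in> words S" "v \<in> words S"
  shows "pres_class S R u \<otimes>\<^bsub>presented_group S R\<^esub> pres_class S R v = pres_class S R (u @ v)"
  using assms unfolding presented_group_def pres_class_def
  by (auto intro: pres_eq.intros pres_eq_append)

lemma pres_eq_winv: "u \<in> words S \<Longrightarrow> pres_eq S R (winv u @ u) []"
proof (induction u)
  case Nil
  then show ?case by (auto simp: winv_def intro: pres_eq.refl)
next
  case (Cons x u)
  then have x: "linv x \<in> S \<times> UNIV" and u: "u \<in> words S"
    by (auto simp: words_def linv_def)
  have "pres_eq S R (winv u @ [linv x, linv (linv x)] @ u) (winv u @ u)"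
    by (rule pres_eq.cancel) (use x u in auto)
  then have "pres_eq S R (winv (x # u) @ x # u) (winv u @ u)"
    by (simp add: winv_def linv_def)
  then show ?case using Cons.IH[OF u] by (rule pres_eq.trans)
qed

lemma group_presented_group: "group (presented_group S R)"
proof (rule groupI)
  fix x assume "x \<in> carrier (presented_group S R)"
  then obtain u where u: "u \<in> words S" "x = pres_class S R u"
    by (auto simp: presented_group_def)
  have "pres_class S R (winv u) \<otimes>\<^bsub>presented_group S R\<^esub> x = \<one>\<^bsub>presented_group S R\<^esub>"
    using u pres_eq_winv[OF u(1)] by (simp add: pres_class_mult pres_class_eq_iff presented_group_def[of S R, THEN arg_cong[of _ _ one]])
  moreover have "pres_class S R (winv u) \<in> carrier (presented_group S R)"
    using u by (auto simp: presented_group_def)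
  ultimately show "\<exists>y\<in>carrier (presented_group S R).
      y \<otimes>\<^bsub>presented_group S R\<^esub> x = \<one>\<^bsub>presented_group S R\<^esub>" by blast
next
  show "\<one>\<^bsub>presented_group S R\<^esub> \<in> carrier (presented_group S R)"
    by (auto simp: presented_group_def)
next
  fix x y assume "x \<in> carrier (presented_group S R)" "y \<in> carrier (presented_group S R)"
  then obtain u v where "u \<in> words S" "x = pres_class S R u" "v \<in> words S" "y = pres_class S R v"
    by (auto simp: presented_group_def)
  then have "x \<otimes>\<^bsub>presented_group S R\<^esub> y = pres_class S R (u @ v)" "u @ v \<in> words S"
    by (auto simp: pres_class_mult)
  then show "x \<otimes>\<^bsub>presented_group S R\<^esub> y \<in> carrier (presented_group S R)"
    by (auto simp: presented_group_def)
next
  fix x y z assume "x \<in> carrier (presented_group S R)" "y \<in> carrier (presented_group S R)"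
    "z \<in> carrier (presented_group S R)"
  then obtain u v w where "u \<in> words S" "x = pres_class S R u" "v \<in> words S" "y = pres_class S R v"
     "w \<in> words S" "z = pres_class S R w"
    by (auto simp: presented_group_def)
  then show "x \<otimes>\<^bsub>presented_group S R\<^esub> y \<otimes>\<^bsub>presented_group S R\<^esub> z =
      x \<otimes>\<^bsub>presented_group S R\<^esub> (y \<otimes>\<^bsub>presented_group S R\<^esub> z)"
    by (simp add: pres_class_mult)
next
  fix x assume "x \<in> carrier (presented_group S R)"
  then obtain u where u: "u \<in> words S" "x = pres_class S R u"
    by (auto simp: presented_group_def)
  have "\<one>\<^bsub>presented_group S R\<^esub> = pres_class S R []" by (simp add: presented_group_def)
  then show "\<one>\<^bsub>presented_group S R\<^esub> \<otimes>\<^bsub>presented_group S R\<^esub> x = x"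
    using u by (simp add: pres_class_mult)
qed

section \<open>Word length, translation length and geodesics\<close>

text \<open>The following notions are only used when \<open>X\<close> generates \<open>G\<close> as a monoid.\<close>

definition word_value :: "('g, 'b) monoid_scheme \<Rightarrow> 'g list \<Rightarrow> 'g" where
  "word_value G xs = foldr (\<otimes>\<^bsub>G\<^esub>) xs \<one>\<^bsub>G\<^esub>"

definition word_length :: "('g, 'b) monoid_scheme \<Rightarrow> 'g set \<Rightarrow> 'g \<Rightarrow> nat" where
  "word_length G X g = (LEAST n. \<exists>xs \<in> lists X. length xs = n \<and> word_value G xs = g)"

text \<open>The limit exists for every \<open>g\<close>, because \<open>n \<mapsto> word_length G X (g\<^sup>n)\<close> is subadditive.\<close>

definition translation_length :: "('g, 'b) monoid_scheme \<Rightarrow> 'g set \<Rightarrow> 'g \<Rightarrow> real" where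
  "translation_length G X g =
     lim (\<lambda>n::nat. real (word_length G X (g [^]\<^bsub>G\<^esub> n)) / real n)"

definition periodically_geodesic :: "('g, 'b) monoid_scheme \<Rightarrow> 'g set \<Rightarrow> 'g \<Rightarrow> bool" where
  "periodically_geodesic G X h \<longleftrightarrow>
     (\<forall>n::int. int (word_length G X (h [^]\<^bsub>G\<^esub> n)) = \<bar>n\<bar> * int (word_length G X h))"

definition conjugate_in :: "('g, 'b) monoid_scheme \<Rightarrow> 'g \<Rightarrow> 'g \<Rightarrow> bool" where
  "conjugate_in G g h \<longleftrightarrow> (\<exists>t\<in>carrier G. h = t \<otimes>\<^bsub>G\<^esub> g \<otimes>\<^bsub>G\<^esub> inv\<^bsub>G\<^esub> t)"

definition geodesic_words :: "('g, 'b) monoid_scheme \<Rightarrow> 'g set \<Rightarrow> 'g list set" where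
  "geodesic_words G X = {xs \<in> lists X. word_length G X (word_value G xs) = length xs}"

section \<open>Regular languages\<close>

text \<open>A language over the finite alphabet \<open>A\<close> is regular if it is accepted by a deterministic
  finite automaton with state set \<open>Q\<close>, transition function \<open>d\<close>, initial state \<open>q0\<close> and accepting
  states \<open>F\<close>.\<close>

definition regular_language :: "'x set \<Rightarrow> 'x list set \<Rightarrow> bool" where
  "regular_language A L \<longleftrightarrow> finite A \<and>
     (\<exists>(Q :: nat set) d q0 F. finite Q \<and> q0 \<in> Q \<and> F \<subseteq> Q \<and> (\<forall>q\<in>Q. \<forall>a\<in>A. d q a \<in> Q) \<and>
        L = {xs \<in> lists A. foldl d q0 xs \<in> F})"

end

theory Submission
  imports Defs
begin

text \<open>The Cayley complex is made of squares, or of triangles, and the small cancellation condition says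
  that the links of its vertices have girth at least four, respectively six. A corner of a path where
  two squares, respectively three triangles, meet on one side is therefore straight. A corner of
  length one less can be flipped to the other side without changing the length of the path, and the
  remaining corners shorten it. Sliding a letter along a path by consecutive flips traces out a strip;
  a strip that ends in a shortening corner shows that the path is not geodesic. The girth conditions
  imply that flips and shortenings are confluent modulo flips, so a word is geodesic if and only if it
  contains no such strip, a property that a finite automaton recognizes.

  Let \<open>v\<close> be a word of minimal length among those representing conjugates of \<open>g\<close>. By minimality, a strip
  along a power of \<open>v\<close> has to go exactly once around \<open>v\<close>. In this case \<open>v\<close> acts as a glide reflection
  along the strip, and the path following one side of the strip represents a conjugate of \<open>g\<^sup>2\<close>, all
  of its corners are straight, and hence all of its powers are geodesic.\<close>

text \<open>Flips are reversible and keep the length, so rewriting does not terminate, and a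
  shortening may become visible only after an unbounded number of flips; comparing single steps is
  therefore not enough. A slide together with the shortening at its end is treated as one step,
  \<open>pat\<close>. The results of two such steps are compared inside words strictly shorter than
  the one they start from, and this drives an induction on length. Words for equal elements then
  have a common descendant, and no step lengthens a word, so a word without a strip is shortest.

  The factor 2 appears because a glide reflection exchanges the two sides of the strip, and only its
  square preserves a side. A word \<open>u\<close> for a conjugate of that square has geodesic
  powers, so the translation length is half the length of \<open>u\<close>.\<close>

section \<open>Flips, shortenings and confluence\<close>

text \<open>Read \<open>sw a b c d\<close> as: the word \<open>ab\<close> can be flipped to \<open>cd\<close>; and \<open>rd a b z\<close> as: \<open>ab\<close> can be shortened to
  \<open>z\<close>.\<close>

inductive swap1 :: "('l \<Rightarrow> 'l \<Rightarrow> 'l \<Rightarrow> 'l \<Rightarrow> bool) \<Rightarrow> 'l list \<Rightarrow> 'l list \<Rightarrow> bool" for sw where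
  "sw a b c d \<Longrightarrow> swap1 sw (p @ [a, b] @ q) (p @ [c, d] @ q)"

inductive red1 :: "('l \<Rightarrow> 'l \<Rightarrow> 'l list \<Rightarrow> bool) \<Rightarrow> 'l list \<Rightarrow> 'l list \<Rightarrow> bool" for rd where
  "rd a b z \<Longrightarrow> red1 rd (p @ [a, b] @ q) (p @ z @ q)"

inductive reach for sw rd where
  reach_refl: "reach sw rd u u"
| reach_swap: "reach sw rd u v \<Longrightarrow> swap1 sw v w \<Longrightarrow> reach sw rd u w"
| reach_red: "reach sw rd u v \<Longrightarrow> red1 rd v w \<Longrightarrow> reach sw rd u w"

text \<open>The bound \<open>n\<close> limits the words at which steps are taken. Two shortenings of
  one word turn out to be connected below its length, which is what the induction in
  \<open>church_rosser\<close> needs.\<close>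

inductive conn for sw rd and n :: nat where
  conn_refl: "conn sw rd n u u"
| conn_sym: "conn sw rd n u v \<Longrightarrow> conn sw rd n v u"
| conn_trans [trans]: "conn sw rd n u v \<Longrightarrow> conn sw rd n v w \<Longrightarrow> conn sw rd n u w"
| conn_swap: "swap1 sw u v \<Longrightarrow> length u \<le> n \<Longrightarrow> conn sw rd n u v"
| conn_red: "red1 rd u v \<Longrightarrow> length u \<le> n \<Longrightarrow> conn sw rd n u v"

text \<open>In \<open>push sw a bs bs' a'\<close> the letter \<open>a\<close> slides over \<open>bs\<close>, so that \<open>a bs\<close> is flipped to \<open>bs' a'\<close>.\<close>

inductive push for sw where
  push_Nil: "push sw a [] [] a"
| push_Cons: "sw a b b' a1 \<Longrightarrow> push sw a1 bs bs' a' \<Longrightarrow> push sw a (b # bs) (b' # bs') a'"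

text \<open>The slide and the shortening form a single step because \<open>red1\<close> alone is not
  stable under flips: a flip next to a shortening corner can turn it into a longer strip.\<close>

inductive pat for sw rd where
  "push sw a bs bs' a' \<Longrightarrow> rd a' y z \<Longrightarrow> pat sw rd (p @ a # bs @ y # q) (p @ bs' @ z @ q)"

definition irreducible where
  "irreducible sw rd w \<longleftrightarrow> (\<nexists>r. pat sw rd w r)"

section \<open>Contexts, strips and overlapping corners\<close>

lemma swap1_ctx: "swap1 sw u v \<Longrightarrow> swap1 sw (p @ u @ q) (p @ v @ q)"
  by (erule swap1.cases) (use swap1.intros[of sw _ _ _ _ "p @ _" "_ @ q"] in auto)

lemma red1_ctx: "red1 rd u v \<Longrightarrow> red1 rd (p @ u @ q) (p @ v @ q)"
  by (erule red1.cases) (use red1.intros[of rd _ _ _ "p @ _" "_ @ q"] in auto)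

lemma conn_ctx:
  "conn sw rd n u v \<Longrightarrow> n + length p + length q \<le> N \<Longrightarrow> conn sw rd N (p @ u @ q) (p @ v @ q)"
  by (induction rule: conn.induct)
    (auto intro: conn.intros swap1_ctx red1_ctx)

lemma conn_mono: "conn sw rd n u v \<Longrightarrow> n \<le> N \<Longrightarrow> conn sw rd N u v"
  using conn_ctx[of sw rd n u v "[]" "[]" N] by simp

lemma reach_trans: "reach sw rd v w \<Longrightarrow> reach sw rd u v \<Longrightarrow> reach sw rd u w"
  by (induction rule: reach.induct) (auto intro: reach.intros)

lemma reach_ctx: "reach sw rd u v \<Longrightarrow> reach sw rd (p @ u @ q) (p @ v @ q)"
  by (induction rule: reach.induct) (auto intro: reach.intros swap1_ctx red1_ctx)

lemma length_swap1: "swap1 sw u v \<Longrightarrow> length v = length u"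
  by (erule swap1.cases) auto

lemma length_push: "push sw a bs bs' a' \<Longrightarrow> length bs' = length bs"
  by (induction rule: push.induct) auto

lemma push_append: "push sw a bs bs' a' \<Longrightarrow> push sw a' cs cs' a'' \<Longrightarrow> push sw a (bs @ cs) (bs' @ cs') a''"
  by (induction rule: push.induct) (auto intro: push.intros)

lemma push_NilD: "push sw a [] bs' a' \<Longrightarrow> bs' = [] \<and> a' = a"
  by (erule push.cases) auto

lemma push_ConsD: "push sw a (b # bs) cs a' \<Longrightarrow>
    \<exists>b' a1 bs'. cs = b' # bs' \<and> sw a b b' a1 \<and> push sw a1 bs bs' a'"
  by (erule push.cases) auto

lemma push_appendD: "push sw a (bs @ cs) ds a'' \<Longrightarrow>
    \<exists>bs' cs' a'. ds = bs' @ cs' \<and> push sw a bs bs' a' \<and> push sw a' cs cs' a''"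
proof (induction bs arbitrary: a ds)
  case Nil
  then show ?case by (auto intro: push_Nil)
next
  case (Cons b bs)
  then obtain b' a1 bs' where "ds = b' # bs'" "sw a b b' a1" "push sw a1 (bs @ cs) bs' a''"
    by (auto dest: push_ConsD)
  with Cons.IH[of a1 bs'] show ?case
    by (metis append_Cons push_Cons)
qed

lemma push_reach: "push sw a bs bs' a' \<Longrightarrow> reach sw rd (a # bs) (bs' @ [a'])"
proof (induction rule: push.induct)
  case (push_Nil a)
  then show ?case by (auto intro: reach.intros)
next
  case (push_Cons a b b' a1 bs bs' a')
  have "swap1 sw (a # b # bs) (b' # a1 # bs)"
    using swap1.intros[of sw a b b' a1 "[]" bs] push_Cons by simp
  then have "reach sw rd (a # b # bs) (b' # a1 # bs)"
    by (auto intro: reach.intros)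
  moreover have "reach sw rd (b' # a1 # bs) (b' # bs' @ [a'])"
    using reach_ctx[OF push_Cons.IH, of "[b']" "[]"] by simp
  ultimately show ?case by (auto intro: reach_trans)
qed

lemma pat_reach: "pat sw rd w r \<Longrightarrow> reach sw rd w r"
proof (induction rule: pat.induct)
  case (1 a bs bs' a' y z p q)
  have "reach sw rd (p @ (a # bs) @ (y # q)) (p @ (bs' @ [a']) @ (y # q))"
    by (rule reach_ctx[OF push_reach[OF 1(1)]])
  moreover have "red1 rd ((p @ bs') @ [a', y] @ q) ((p @ bs') @ z @ q)"
    using 1(2) by (rule red1.intros)
  ultimately show ?case by (auto intro: reach.intros)
qed

lemma pat_ctx: "pat sw rd u r \<Longrightarrow> pat sw rd (p @ u @ q) (p @ r @ q)"
proof (erule pat.cases, goal_cases)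
  case (1 a bs bs' a' y z p' q')
  then show ?case using pat.intros[of sw a bs bs' a' rd y z "p @ p'" "q' @ q"] by simp
qed

lemma red1_pat: "red1 rd u r \<Longrightarrow> pat sw rd u r"
proof (erule red1.cases, goal_cases)
  case (1 a b z p q)
  then show ?case using pat.intros[of sw a "[]" "[]" a rd b z p q] push_Nil[of sw a] by simp
qed

text \<open>Enumerates the overlaps of a corner with a strip: left of it, across its left end,
  inside, across its right end, right of it.\<close>

lemma pair_split_cases:
  assumes "p @ us @ q = p2 @ [c, d] @ q2" "us \<noteq> []"
  obtains x where "p = p2 @ [c, d] @ x" "q2 = x @ us @ q"
  | us' where "p = p2 @ [c]" "us = d # us'" "q2 = us' @ q"
  | x y where "us = x @ [c, d] @ y" "p2 = p @ x" "q2 = y @ q"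
  | us' where "us = us' @ [c]" "q = d # q2" "p2 = p @ us'"
  | x where "q = x @ [c, d] @ q2" "p2 = p @ us @ x"
proof -
  consider (A) e where "p @ e = p2" "us @ q = e @ c # d # q2" | (B) e where "p = p2 @ e" "e @ us @ q = c # d # q2"
    using assms(1) by (auto simp: append_eq_append_conv2)
  then show thesis
  proof cases
    case B
    show thesis
    proof (cases e)
      case Nil
      then show thesis using B assms(2) that(3)[of "[]"] that(4)[of "[]"]
        by (auto simp: append_eq_Cons_conv Cons_eq_append_conv)
    next
      case (Cons e1 es)
      then show thesis using B assms(2) that(1) that(2)
        by (cases es) (auto simp: append_eq_Cons_conv Cons_eq_append_conv)
    qed
  next
    case A
    from A(2) consider (C) f where "us @ f = e" "q = f @ c # d # q2" | (D) f where "us = e @ f" "f @ q = c # d # q2"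
      by (auto simp: append_eq_append_conv2)
    then show thesis
    proof cases
      case C
      then show thesis using that(5)[of f] A by auto
    next
      case D
      then show thesis using that(5)[of "[]"] that(4)[of e] that(3)[of e] A
        by (auto simp: append_eq_Cons_conv Cons_eq_append_conv)
    qed
  qed
qed

text \<open>Refines the case of a corner inside the word under a strip: the whole word, its first
  corner, its last corner, or an interior one.\<close>

lemma pair_in_pattern_cases:
  assumes "a # bs @ [y] = x @ [c, d] @ w"
  obtains "x = []" "bs = []" "c = a" "d = y" "w = []"
  | bs2 where "x = []" "c = a" "bs = d # bs2" "w = bs2 @ [y]"
  | x2 where "x = a # x2" "bs = x2 @ [c]" "d = y" "w = []"
  | x2 w2 where "x = a # x2" "bs = x2 @ [c, d] @ w2" "w = w2 @ [y]"
proof (cases x)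
  case Nil
  then show thesis using assms that(1,2) by (cases bs) auto
next
  case (Cons x1 x2)
  show thesis
  proof (cases w rule: rev_cases)
    case Nil
    with Cons assms have "bs @ [y] = (x2 @ [c]) @ [d]" by simp
    then have "bs = x2 @ [c]" "y = d" by blast+
    then show thesis using that(3) Nil Cons assms by auto
  next
    case (snoc w2 w1)
    with Cons assms have "bs @ [y] = (x2 @ [c, d] @ w2) @ [w1]" by simp
    then have "bs = x2 @ [c, d] @ w2" "y = w1" by blast+
    then show thesis using that(4) snoc Cons assms by auto
  qed
qed

text \<open>Every condition involves words of at most three letters, so it can be read off the links.\<close>

locale flip_system =
  fixes sw :: "'l \<Rightarrow> 'l \<Rightarrow> 'l \<Rightarrow> 'l \<Rightarrow> bool" and rd :: "'l \<Rightarrow> 'l \<Rightarrow> 'l list \<Rightarrow> bool"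
  assumes sw_sym: "sw a b c d \<Longrightarrow> sw c d a b"
    and sw_fun: "sw a b c d \<Longrightarrow> sw a b c' d' \<Longrightarrow> c' = c \<and> d' = d"
    and rd_fun: "rd a b z \<Longrightarrow> rd a b z' \<Longrightarrow> z' = z"
    and rd_length: "rd a b z \<Longrightarrow> length z \<le> 1"
    and sw_not_rd: "sw a b c d \<Longrightarrow> \<not> rd a b z"
    and rd_rd: "rd a b z \<Longrightarrow> rd b c z' \<Longrightarrow> conn sw rd 2 (z @ [c]) (a # z')"
    and rd_sw_right: "rd a b z \<Longrightarrow> sw b c c' b' \<Longrightarrow>
      (\<exists>z'. rd a c' z' \<and> conn sw rd 2 (z' @ [b']) (z @ [c])) \<or>
      (\<exists>c2 a2 z2. sw a c' c2 a2 \<and> rd a2 b' z2 \<and> conn sw rd 2 (c2 # z2) (z @ [c]))"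
    and rd_sw_left: "rd d a z1 \<Longrightarrow> sw a b b' a1 \<Longrightarrow>
      \<exists>e q z2. length q \<le> 1 \<and> conn sw rd 2 [d, b'] (q @ [e]) \<and> rd e a1 z2 \<and> conn sw rd 2 (q @ z2) (z1 @ [b])"
    and sw_rd_sw: "sw a b b' a' \<Longrightarrow> rd a' y z \<Longrightarrow> sw b y y1 b1 \<Longrightarrow>
      \<exists>z1. rd a y1 z1 \<and> conn sw rd 2 (z1 @ [b1]) (b' # z)"
    and sw_rd_rd: "sw a b b' a' \<Longrightarrow> rd a' y z' \<Longrightarrow> rd b y z \<Longrightarrow> conn sw rd 2 (b' # z') (a # z)"
    and sw_sw: "sw a b b' a' \<Longrightarrow> sw a' c c' a'' \<Longrightarrow> \<not> sw b c u v"
    and sw_sw_rd: "sw a b b' a' \<Longrightarrow> sw a' c c' a'' \<Longrightarrow> rd b c z \<Longrightarrow>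
      \<exists>z'. rd b' c' z' \<and> conn sw rd 2 (a # z) (z' @ [a''])"
begin

abbreviation "cn \<equiv> conn sw rd"
abbreviation "rch \<equiv> reach sw rd"

section \<open>Strips under flips and shortenings\<close>

lemma length_red1: "red1 rd u v \<Longrightarrow> length v < length u"
  by (erule red1.cases) (use rd_length in fastforce)

lemma reach_length: "rch u v \<Longrightarrow> length v \<le> length u"
  by (induction rule: reach.induct) (auto dest: length_red1 length_swap1)

lemma reach_conn: "rch u v \<Longrightarrow> length u \<le> n \<Longrightarrow> cn n u v"
proof (induction rule: reach.induct)
  case (reach_swap u v w)
  with reach_length[of u v] show ?case by (auto intro: conn_trans[OF _ conn_swap])
next
  case (reach_red u v w)
  with reach_length[of u v] show ?case by (auto intro: conn_trans[OF _ conn_red])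
qed (rule conn_refl)

lemma pat_length: "pat sw rd w r \<Longrightarrow> length r < length w"
  by (erule pat.cases) (use rd_length length_push in fastforce)

lemma swap1_sym: "swap1 sw u v \<Longrightarrow> swap1 sw v u"
  by (erule swap1.cases) (auto intro: swap1.intros[simplified] sw_sym)

text \<open>On the side of the strip the corner \<open>b c\<close> is already straight, and
  \<open>sw_sw\<close> says that such a corner cannot flip.\<close>

lemma push_no_sw:
  assumes "push sw a (xs @ [b, c] @ ys) bs' a'"
  shows "\<not> sw b c u v"
  using assms sw_sw by (fastforce dest!: push_appendD push_ConsD)

text \<open>A flip next to a strip or at one of its ends lengthens or shortens the strip, and there are no
  flips in its interior. So the presence of a strip is invariant under flips.\<close>

lemma transport_core:
  assumes P: "push sw a bs bs' a'" and r: "rd a' y z" and s: "swap1 sw (a # bs @ [y]) w"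
  shows "\<exists>r2. pat sw rd w r2 \<and> cn (length bs + 1) (bs' @ z) r2"
proof -
  from s obtain x c d c2 d2 t where eq: "a # bs @ [y] = x @ [c, d] @ t" and w: "w = x @ [c2, d2] @ t"
    and sw: "sw c d c2 d2" by (auto elim!: swap1.cases)
  from eq show ?thesis
  proof (cases rule: pair_in_pattern_cases)
    case 1
    then show ?thesis using P r sw sw_not_rd by (auto dest: push_NilD)
  next
    \<comment> \<open>The flip is the first step of the slide; the rest of the strip starts at
      \<open>d2\<close> and leads to the same word.\<close>
    case (2 bs2)
    with P obtain b' a1 bs'' where b: "bs' = b' # bs''" "sw a d b' a1" "push sw a1 bs2 bs'' a'"
      by (auto dest: push_ConsD)
    with 2 sw sw_fun have "b' = c2" "a1 = d2" by blast+
    then have "pat sw rd ([c2] @ d2 # bs2 @ y # []) ([c2] @ bs'' @ z @ [])"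
      using b r by (intro pat.intros) auto
    then show ?thesis using 2 w b \<open>b' = c2\<close> by (auto intro: conn_refl)
  next
    \<comment> \<open>The flip changes the last two letters under the strip; by
      \<open>sw_rd_sw\<close> the strip now ends one letter earlier.\<close>
    case (3 x2)
    with P obtain xs' b' \<alpha> where x: "push sw a x2 xs' \<alpha>" "bs' = xs' @ [b']" "sw \<alpha> c b' a'"
      by (auto dest!: push_appendD push_ConsD push_NilD)
    from sw_rd_sw[OF x(3) r] sw 3 obtain z1 where z1: "rd \<alpha> c2 z1" "cn 2 (z1 @ [d2]) (b' # z)" by blast
    have "pat sw rd ([] @ a # x2 @ c2 # [d2]) ([] @ xs' @ z1 @ [d2])"
      using x z1 by (intro pat.intros) auto
    moreover have "cn (length bs + 1) (xs' @ (z1 @ [d2]) @ []) (xs' @ (b' # z) @ [])"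
      by (rule conn_ctx[OF z1(2)]) (use length_push[OF x(1)] 3 in auto)
    ultimately show ?thesis using w 3 x by (auto intro: conn_sym)
  next
    case (4 x2 w2)
    then show ?thesis using P sw push_no_sw by blast
  qed
qed

text \<open>Persistence of the strip is not enough; its result must be controlled too. The bound
  \<open>length w - 1\<close> keeps this comparison below \<open>w\<close>, as the induction for
  confluence requires.\<close>

lemma transport:
  assumes "pat sw rd w r" and s: "swap1 sw w w2"
  shows "\<exists>r2. pat sw rd w2 r2 \<and> cn (length w - 1) r r2"
  using assms(1)
proof cases
  case (1 a bs bs' a' y z p q)
  note w = 1(1) and rr = 1(2) and P = 1(3) and r = 1(4)
  note lens = length_push[OF P] rd_length[OF r]
  from s obtain p2 c d c2 d2 q2 where eq: "w = p2 @ [c, d] @ q2" and w2: "w2 = p2 @ [c2, d2] @ q2"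
    and sw: "sw c d c2 d2" by (auto elim!: swap1.cases)
  have "p @ (a # bs @ [y]) @ q = p2 @ [c, d] @ q2" "a # bs @ [y] \<noteq> []" using w eq by simp_all
  then show ?thesis
  proof (cases rule: pair_split_cases)
    case (1 x)
    have "pat sw rd ((p2 @ [c2, d2] @ x) @ a # bs @ y # q) ((p2 @ [c2, d2] @ x) @ bs' @ z @ q)"
      using P r by (rule pat.intros)
    moreover have "cn (length w - 1) r (p2 @ [c2, d2] @ x @ bs' @ z @ q)"
      using swap1.intros[of sw c d c2 d2 p2 "x @ bs' @ z @ q", OF sw] rr w 1 lens
      by (auto intro!: conn_swap)
    ultimately show ?thesis using w2 1 by auto
  next
    \<comment> \<open>Undoing the flip slides \<open>c2\<close> over \<open>d2\<close> into
      \<open>c\<close> and \<open>a\<close>, so the strip grows by one letter on the left and its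
      result is unchanged.\<close>
    case (2 us')
    then have "push sw c2 (d2 # bs) (c # bs') a'"
      using P push_Cons[of sw c2 d2 c d bs bs' a'] sw_sym[OF sw] by simp
    then have "pat sw rd (p2 @ c2 # (d2 # bs) @ y # q) (p2 @ (c # bs') @ z @ q)"
      using r by (rule pat.intros)
    then show ?thesis using w2 2 rr by (auto intro: conn_refl)
  next
    case (3 x t)
    have "swap1 sw (a # bs @ [y]) (x @ [c2, d2] @ t)"
      using swap1.intros[of sw c d c2 d2 x t, OF sw] 3 by simp
    from transport_core[OF P r this] obtain r2 where
      r2: "pat sw rd (x @ [c2, d2] @ t) r2" "cn (length bs + 1) (bs' @ z) r2" by blast
    have "cn (length w - 1) (p @ (bs' @ z) @ q) (p @ r2 @ q)"
      by (rule conn_ctx[OF r2(2)]) (use w in auto)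
    then show ?thesis using pat_ctx[OF r2(1), of p q] w2 3 rr by auto
  next
    \<comment> \<open>The flip replaces \<open>y\<close> by \<open>c2\<close>: either the strip
      still shortens against \<open>c2\<close>, or it runs on over \<open>c2\<close> and shortens
      against \<open>d2\<close>.\<close>
    case (4 us')
    then have cy: "c = y" "us' = a # bs" by (metis append_Cons last_snoc, metis append_Cons butlast_snoc)
    from rd_sw_right[OF r] sw cy consider
      (A) z' where "rd a' c2 z'" "cn 2 (z' @ [d2]) (z @ [d])" |
      (B) c3 a3 z3 where "sw a' c2 c3 a3" "rd a3 d2 z3" "cn 2 (c3 # z3) (z @ [d])" by blast
    then show ?thesis
    proof cases
      case A
      have "pat sw rd (p @ a # bs @ c2 # (d2 # q2)) (p @ bs' @ z' @ (d2 # q2))"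
        using P A(1) by (rule pat.intros)
      moreover have "cn (length w - 1) ((p @ bs') @ (z' @ [d2]) @ q2) ((p @ bs') @ (z @ [d]) @ q2)"
        by (rule conn_ctx[OF A(2)]) (use w lens 4 in auto)
      ultimately show ?thesis using w2 4 cy rr by (auto intro: conn_sym)
    next
      case B
      have "push sw a (bs @ [c2]) (bs' @ [c3]) a3"
        using P B(1) by (auto intro!: push_append push.intros)
      from pat.intros[of sw a "bs @ [c2]" "bs' @ [c3]" a3 rd d2 z3 p q2, OF this B(2)] have "pat sw rd (p @ a # bs @ c2 # d2 # q2) (p @ bs' @ c3 # z3 @ q2)"
        by simp
      moreover have "cn (length w - 1) ((p @ bs') @ (c3 # z3) @ q2) ((p @ bs') @ (z @ [d]) @ q2)"
        by (rule conn_ctx[OF B(3)]) (use w lens 4 in auto)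
      ultimately show ?thesis using w2 4 cy rr by (auto intro: conn_sym)
    qed
  next
    case (5 x)
    have "pat sw rd (p @ a # bs @ y # (x @ [c2, d2] @ q2)) (p @ bs' @ z @ (x @ [c2, d2] @ q2))"
      using P r by (rule pat.intros)
    moreover have "cn (length w - 1) r (p @ bs' @ z @ (x @ [c2, d2] @ q2))"
      using swap1.intros[of sw c d c2 d2 "p @ bs' @ z @ x" "q2", OF sw] rr w 5 lens
      by (auto intro!: conn_swap)
    ultimately show ?thesis using w2 5 by auto
  qed
qed

text \<open>The shortening of \<open>d a\<close> at the start of the strip is carried across it
  letter by letter with \<open>rd_sw_left\<close>, until it meets the final shortening, where
  \<open>rd_rd\<close> applies.\<close>

lemma push_rd_left:
  assumes "push sw a bs bs' a'" "rd a' y z" "rd d a z1"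
  shows "cn (length bs + 2) (d # bs' @ z) (z1 @ bs @ [y])"
  using assms
proof (induction arbitrary: d z1 rule: push.induct)
  case (push_Nil a)
  then show ?case using rd_rd[of d a z1 y z] by (auto intro: conn_sym simp: numeral_2_eq_2)
next
  case (push_Cons a b b' a1 bs bs' a')
  from rd_sw_left[OF push_Cons.prems(2) push_Cons.hyps(1)] obtain e q z2 where
    e: "length q \<le> 1" "cn 2 [d, b'] (q @ [e])" "rd e a1 z2" "cn 2 (q @ z2) (z1 @ [b])" by blast
  note l = length_push[OF push_Cons.hyps(2)] rd_length[OF push_Cons.prems(1)]
  have "cn (length (b # bs) + 2) ([] @ [d, b'] @ (bs' @ z)) ([] @ (q @ [e]) @ (bs' @ z))"
    by (rule conn_ctx[OF e(2)]) (use l in auto)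
  also have "cn (length (b # bs) + 2) (q @ (e # bs' @ z) @ []) (q @ (z2 @ bs @ [y]) @ [])"
    by (rule conn_ctx[OF push_Cons.IH[OF push_Cons.prems(1) e(3)]]) (use e in auto)
  then have "cn (length (b # bs) + 2) ([] @ (q @ [e]) @ (bs' @ z)) ([] @ (q @ z2) @ (bs @ [y]))" by simp
  also have "cn (length (b # bs) + 2) ([] @ (q @ z2) @ (bs @ [y])) ([] @ (z1 @ [b]) @ (bs @ [y]))"
    by (rule conn_ctx[OF e(4)]) auto
  finally show ?case by simp
qed

text \<open>Here the competing corner lies under the strip. If it is interior, the opposite corner
  on the other side of the strip shortens as well (\<open>sw_sw_rd\<close>), and the strip slides
  past the shortened place.\<close>

lemma join_core:
  assumes P: "push sw a bs bs' a'" and r: "rd a' y z" and s: "red1 rd (a # bs @ [y]) w"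
  shows "cn (length bs + 1) (bs' @ z) w"
proof -
  note lens = length_push[OF P] rd_length[OF r]
  from s obtain x c d z2 t where eq: "a # bs @ [y] = x @ [c, d] @ t" and w: "w = x @ z2 @ t"
    and rd: "rd c d z2" by (auto elim!: red1.cases)
  from eq show ?thesis
  proof (cases rule: pair_in_pattern_cases)
    case 1
    with P have "bs' = []" "a' = a" by (auto dest: push_NilD)
    then show ?thesis using 1 r rd rd_fun[of a y z z2] w by (auto intro: conn_refl)
  next
    case (2 bs2)
    then show ?thesis using P rd sw_not_rd by (auto dest: push_ConsD)
  next
    case (3 x2)
    with P obtain xs' b' \<alpha> where x: "push sw a x2 xs' \<alpha>" "bs' = xs' @ [b']" "sw \<alpha> c b' a'"
      by (auto dest!: push_appendD push_ConsD push_NilD)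
    note l = length_push[OF x(1)] rd_length[OF rd]
    from sw_rd_rd[OF x(3) r] rd 3 have cc: "cn 2 (b' # z) (\<alpha> # z2)" by simp
    have "cn (length bs + 1) (xs' @ (b' # z) @ []) (xs' @ (\<alpha> # z2) @ [])"
      by (rule conn_ctx[OF cc]) (use 3 l in auto)
    also have "cn (length bs + 1) (([] @ (xs' @ [\<alpha>]) @ z2)) ([] @ (a # x2) @ z2)"
      by (intro conn_sym[OF reach_conn] reach_ctx push_reach[OF x(1)]) (use 3 l in auto)
    then have "cn (length bs + 1) (xs' @ (\<alpha> # z2) @ []) (a # x2 @ z2)" by simp
    finally show ?thesis using x w 3 by simp
  next
    case (4 x2 w2)
    with P obtain xs' b' c' \<alpha> \<beta> \<gamma> ws where x: "push sw a x2 xs' \<alpha>" "bs' = xs' @ [b', c'] @ ws"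
      "sw \<alpha> c b' \<beta>" "sw \<beta> d c' \<gamma>" "push sw \<gamma> w2 ws a'"
      by (auto dest!: push_appendD push_ConsD push_NilD)
    note l = length_push[OF x(1)] rd_length[OF rd] length_push[OF x(5)] rd_length[OF r]
    from sw_sw_rd[OF x(3,4) rd] obtain z3 where z3: "rd b' c' z3" "cn 2 (\<alpha> # z2) (z3 @ [\<gamma>])" by blast
    note l = l rd_length[OF z3(1)]
    have "cn (length bs + 1) (xs' @ [b', c'] @ (ws @ z)) (xs' @ z3 @ (ws @ z))"
      by (intro conn_red red1.intros z3) (use 4 l in auto)
    also have "cn (length bs + 1) (xs' @ z3 @ (ws @ z)) (xs' @ z3 @ \<gamma> # w2 @ [y])"
    proof (rule conn_sym, rule reach_conn)
      have "pat sw rd ((xs' @ z3) @ \<gamma> # w2 @ y # []) ((xs' @ z3) @ ws @ z @ [])"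
        using x(5) r by (rule pat.intros)
      then show "rch (xs' @ z3 @ \<gamma> # w2 @ [y]) (xs' @ z3 @ ws @ z)"
        using pat_reach by fastforce
    qed (use 4 l in auto)
    also have "cn (length bs + 1) (xs' @ (z3 @ [\<gamma>]) @ (w2 @ [y])) (xs' @ (\<alpha> # z2) @ (w2 @ [y]))"
      by (rule conn_ctx[OF conn_sym[OF z3(2)]]) (use 4 l in auto)
    then have "cn (length bs + 1) (xs' @ z3 @ \<gamma> # w2 @ [y]) (xs' @ \<alpha> # z2 @ w2 @ [y])" by simp
    also have "cn (length bs + 1) ([] @ (xs' @ [\<alpha>]) @ (z2 @ w2 @ [y])) ([] @ (a # x2) @ (z2 @ w2 @ [y]))"
      by (intro conn_sym[OF reach_conn] reach_ctx push_reach[OF x(1)]) (use 4 l in auto)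
    then have "cn (length bs + 1) (xs' @ \<alpha> # z2 @ w2 @ [y]) (a # x2 @ z2 @ w2 @ [y])" by simp
    finally show ?thesis using x w 4 by simp
  qed
qed

text \<open>It is enough that one of the two shortenings is a strip: \<open>transport\<close>
  carries it along flips to the word where the other, plain one takes place.\<close>

lemma join:
  assumes "pat sw rd w r" and s: "red1 rd w w2"
  shows "cn (length w - 1) r w2"
  using assms(1)
proof cases
  case (1 a bs bs' a' y z p q)
  note w = 1(1) and rr = 1(2) and P = 1(3) and r = 1(4)
  note lens = length_push[OF P] rd_length[OF r]
  from s obtain p2 c d z2 q2 where eq: "w = p2 @ [c, d] @ q2" and w2: "w2 = p2 @ z2 @ q2"
    and rd: "rd c d z2" by (auto elim!: red1.cases)
  note lens = lens rd_length[OF rd]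
  have "p @ (a # bs @ [y]) @ q = p2 @ [c, d] @ q2" "a # bs @ [y] \<noteq> []" using w eq by simp_all
  then show ?thesis
  proof (cases rule: pair_split_cases)
    case (1 x)
    have "cn (length w - 1) (p2 @ [c, d] @ (x @ bs' @ z @ q)) (p2 @ z2 @ (x @ bs' @ z @ q))"
      by (intro conn_red red1.intros rd) (use w 1 lens in auto)
    also have "cn (length w - 1) (p2 @ z2 @ (x @ bs' @ z @ q)) w2"
    proof (rule conn_sym, rule reach_conn[OF pat_reach])
      show "pat sw rd w2 (p2 @ z2 @ x @ bs' @ z @ q)"
        using pat.intros[of sw a bs bs' a' rd y z "p2 @ z2 @ x" q] P r w2 1 by simp
    qed (use w w2 1 lens in auto)
    finally show ?thesis using rr 1 by simp
  next
    case (2 us')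
    then have "cn (length bs + 2) (c # bs' @ z) (z2 @ bs @ [y])"
      using push_rd_left[OF P r] rd by auto
    then have "cn (length w - 1) (p2 @ (c # bs' @ z) @ q) (p2 @ (z2 @ bs @ [y]) @ q)"
      by (rule conn_ctx) (use w 2 in auto)
    then show ?thesis using rr w2 2 by auto
  next
    case (3 x t)
    have "red1 rd (a # bs @ [y]) (x @ z2 @ t)"
      using red1.intros[of rd c d z2 x t, OF rd] 3 by simp
    from join_core[OF P r this] 
    have "cn (length w - 1) (p @ (bs' @ z) @ q) (p @ (x @ z2 @ t) @ q)"
      by (rule conn_ctx) (use w in auto)
    then show ?thesis using w2 3 rr by auto
  next
    \<comment> \<open>Both shortenings use \<open>y\<close>; \<open>rd_rd\<close> reconciles them,
      and \<open>a'\<close> slides back to \<open>a\<close>.\<close>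
    case (4 us')
    then have cy: "c = y" "us' = a # bs" by (metis append_Cons last_snoc, metis append_Cons butlast_snoc)
    from rd_rd[OF r] rd cy have zz: "cn 2 (z @ [d]) (a' # z2)" by blast
    have "cn (length w - 1) ((p @ bs') @ (z @ [d]) @ q2) ((p @ bs') @ (a' # z2) @ q2)"
      by (rule conn_ctx[OF zz]) (use w lens 4 in auto)
    also have "cn (length w - 1) (p @ (bs' @ [a']) @ (z2 @ q2)) (p @ (a # bs) @ (z2 @ q2))"
      by (intro conn_sym[OF reach_conn] reach_ctx push_reach[OF P]) (use w 4 lens in auto)
    then have "cn (length w - 1) ((p @ bs') @ (a' # z2) @ q2) (p @ (a # bs) @ (z2 @ q2))" by simp
    finally show ?thesis using w2 4 cy rr by simp
  next
    case (5 x)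
    have "cn (length w - 1) ((p @ bs' @ z @ x) @ [c, d] @ q2) ((p @ bs' @ z @ x) @ z2 @ q2)"
      by (intro conn_red red1.intros rd) (use w 5 lens in auto)
    also have "cn (length w - 1) ((p @ bs' @ z @ x) @ z2 @ q2) w2"
    proof (rule conn_sym, rule reach_conn[OF pat_reach])
      show "pat sw rd w2 ((p @ bs' @ z @ x) @ z2 @ q2)"
        using pat.intros[of sw a bs bs' a' rd y z p "x @ z2 @ q2"] P r w2 5 by simp
    qed (use w w2 5 lens in auto)
    finally show ?thesis using rr 5 by simp
  qed
qed

section \<open>Confluence modulo flips\<close>

lemma transport_swaps:
  assumes "(swap1 sw)\<^sup>*\<^sup>* u v" "pat sw rd u r"
  shows "\<exists>r'. pat sw rd v r' \<and> cn (length u - 1) r r'"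
  using assms
proof (induction rule: rtranclp_induct)
  case base
  then show ?case by (auto intro: conn_refl)
next
  case (step v w)
  have "(swap1 sw)\<^sup>*\<^sup>* u v \<Longrightarrow> length v = length u"
    by (induction rule: rtranclp_induct) (auto dest: length_swap1)
  with step transport[of v _ w] show ?case by (metis conn_trans)
qed

lemma reach_cases:
  assumes "rch u v"
  shows "(swap1 sw)\<^sup>*\<^sup>* u v \<or> (\<exists>x y. (swap1 sw)\<^sup>*\<^sup>* u x \<and> red1 rd x y \<and> rch y v)"
  using assms by (induction rule: reach.induct) (auto intro: reach.intros rtranclp.intros)

lemma swaps_sym: "(swap1 sw)\<^sup>*\<^sup>* u v \<Longrightarrow> (swap1 sw)\<^sup>*\<^sup>* v u"
  by (induction rule: rtranclp_induct) (auto dest: swap1_sym intro: converse_rtranclp_into_rtranclp)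

lemma swaps_reach: "(swap1 sw)\<^sup>*\<^sup>* u v \<Longrightarrow> rch u v"
  by (induction rule: rtranclp_induct) (auto intro: reach.intros)

lemma swaps_length: "(swap1 sw)\<^sup>*\<^sup>* u v \<Longrightarrow> length v = length u"
  by (induction rule: rtranclp_induct) (auto dest: length_swap1)

text \<open>At a peak, the first shortening on each branch starts from a word that differs from the
  top only by flips. \<open>transport_swaps\<close> and \<open>join\<close> connect the two results
  in words shorter than the top, where the induction hypothesis applies.\<close>

lemma church_rosser: "cn n u v \<Longrightarrow> \<exists>w. rch u w \<and> rch v w"
proof (induction n arbitrary: u v rule: less_induct)
  case (less n)
  have peak: "\<exists>w. rch x w \<and> rch y w" if vx: "rch v x" and vy: "rch v y" and "length v \<le> n" for v x y
  proof -
    consider "(swap1 sw)\<^sup>*\<^sup>* v x" | "(swap1 sw)\<^sup>*\<^sup>* v y" |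
      (C) x1 x2 y1 y2 where "(swap1 sw)\<^sup>*\<^sup>* v x1" "red1 rd x1 x2" "rch x2 x"
        "(swap1 sw)\<^sup>*\<^sup>* v y1" "red1 rd y1 y2" "rch y2 y"
      using reach_cases[OF vx] reach_cases[OF vy] by blast
    then show ?thesis
    proof cases
      case C
      have l: "length x1 = length v" "length y1 = length v" "length x2 < length v" "length y2 < length v"
        using C length_red1[OF C(2)] length_red1[OF C(5)] swaps_length by auto
      have "(swap1 sw)\<^sup>*\<^sup>* x1 y1" using swaps_sym[OF C(1)] C(4) by simp
      from transport_swaps[OF this red1_pat[OF C(2)]] obtain r
        where r: "pat sw rd y1 r" "cn (length v - 1) x2 r" using l by auto
      have "cn (length v - 1) r y2" using join[OF r(1) C(5)] l by simp
      with r(2) have "cn (length v - 1) x2 y2" by (rule conn_trans)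
      moreover have "cn (length v - 1) x2 x" "cn (length v - 1) y2 y"
        using C l by (auto intro: reach_conn)
      ultimately have "cn (length v - 1) x y" by (meson conn_sym conn_trans)
      moreover have "length v - 1 < n" using l \<open>length v \<le> n\<close> by linarith
      ultimately show ?thesis using less.IH by blast
    qed (use vx vy swaps_sym swaps_reach reach_trans reach_refl in blast)+
  qed
  from less.prems show ?case
  proof (induction rule: conn.induct)
    case (conn_trans u v w)
    then obtain x y where xy: "rch u x" "rch v x" "rch v y" "rch w y" by blast
    show ?case
    proof (cases "length v \<le> n")
      case True
      then show ?thesis using peak[OF xy(2,3)] xy reach_trans by meson
    next
      case False
      \<comment> \<open>No step is available at a word longer than \<open>n\<close>, so such a word
        is connected only to itself.\<close>
      have eq: "cn n u v \<Longrightarrow> length u > n \<or> length v > n \<Longrightarrow> u = v" for u v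
        by (induction rule: conn.induct) (auto dest: length_swap1 length_red1)
      then show ?thesis using conn_trans False by (metis linorder_not_le)
    qed
  qed (blast intro: reach.intros)+
qed

lemma irreducible_reach:
  assumes "irreducible sw rd u" "rch u v"
  shows "length v = length u"
proof -
  have "\<not> ((swap1 sw)\<^sup>*\<^sup>* u x \<and> red1 rd x y)" for x y
    using assms(1) swaps_sym transport_swaps red1_pat unfolding irreducible_def by metis
  with reach_cases[OF assms(2)] show ?thesis using swaps_length by auto
qed

lemma irreducible_minimal:
  assumes "irreducible sw rd u" "cn n u v"
  shows "length u \<le> length v"
  using church_rosser[OF assms(2)] irreducible_reach[OF assms(1)] reach_length by fastforce

text \<open>A single letter has no corner, so it reaches only itself. This makes different letters
  different elements of the group.\<close>

lemma conn_single: 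
  assumes "cn n [a] [b]" shows "a = b"
proof -
  have "rch u v \<Longrightarrow> length u = 1 \<Longrightarrow> v = u" for u v
    by (induction rule: reach.induct) (auto elim!: swap1.cases red1.cases)
  from this[of "[a]"] this[of "[b]"] church_rosser[OF assms] show ?thesis by auto
qed

end

section \<open>Axes\<close>

definition flat where
  "flat sw rd x y \<longleftrightarrow> (\<forall>c d. \<not> sw x y c d) \<and> (\<forall>z. \<not> rd x y z)"

lemma push_append_rightD: "push sw a ds (bs' @ cs') a'' \<Longrightarrow>
    \<exists>bs cs a'. ds = bs @ cs \<and> push sw a bs bs' a' \<and> push sw a' cs cs' a''"
proof (induction bs' arbitrary: a ds)
  case Nil
  then show ?case by (auto intro: push_Nil)
next
  case (Cons b' bs')
  then obtain b a1 ds' where "ds = b # ds'" "sw a b b' a1" "push sw a1 ds' (bs' @ cs') a''"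
    by (auto elim: push.cases)
  with Cons.IH[of a1 ds'] show ?case
    by (metis append_Cons push_Cons)
qed

lemma successivelyI:
  assumes "\<And>p c d q. w = p @ [c, d] @ q \<Longrightarrow> P c d"
  shows "successively P w"
  unfolding successively_conv_nth
proof (intro allI impI)
  fix i assume "Suc i < length w"
  then have "w = take i w @ [w ! i, w ! Suc i] @ drop (Suc (Suc i)) w"
    by (simp add: Cons_nth_drop_Suc)
  then show "P (w ! i) (w ! Suc i)" by (rule assms)
qed

text \<open>The first corner of any strip flips, or shortens if the strip slides over
  nothing.\<close>

lemma flat_irreducible:
  assumes "successively (flat sw rd) w" shows "irreducible sw rd w"
proof -
  have False if "pat sw rd w r" for r
    using that
  proof cases
    case (1 a bs bs' a' y z p q)
    show ?thesis
    proof (cases bs)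
      case Nil
      then show ?thesis using assms 1 by (auto simp: flat_def successively_append_iff dest!: push_NilD)
    next
      case (Cons b bs2)
      then show ?thesis using assms 1 by (auto simp: flat_def successively_append_iff dest!: push_ConsD)
    qed
  qed
  then show ?thesis by (auto simp: irreducible_def)
qed

text \<open>\<open>u @ u\<close> contains every corner of every power, including the one between
  consecutive copies.\<close>

lemma successively_concat_replicate:
  assumes "successively P (u @ u)"
  shows "successively P (concat (replicate n u))"
proof (induction n)
  case (Suc n)
  then show ?case using assms by (cases n) (auto simp: successively_append_iff)
qed simp

lemma length_concat_replicate [simp]: "length (concat (replicate n v)) = n * length v"
  by (induction n) auto

lemma nth_concat_replicate: "i < n * length v \<Longrightarrow> concat (replicate n v) ! i = v ! (i mod length v)"
proof (induction n arbitrary: i)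
  case (Suc n)
  then show ?case by (auto simp: nth_append le_mod_geq)
qed simp

text \<open>The condition \<open>turn\<close> concerns the place where a strip ends and its translate starts on the other side
  of the path; its second alternative is the case of squares in which the two overlap.\<close>

locale flip_axis_system = flip_system sw rd
  for sw :: "'l \<Rightarrow> 'l \<Rightarrow> 'l \<Rightarrow> 'l \<Rightarrow> bool" and rd :: "'l \<Rightarrow> 'l \<Rightarrow> 'l list \<Rightarrow> bool" +
  assumes sw_sw': "sw a b b' a' \<Longrightarrow> sw a' c c' a'' \<Longrightarrow> \<not> sw b' c' u v"
    and sw_self: "sw a a b c \<Longrightarrow> \<not> rd c a z"
    and rd_self: "rd a a z \<Longrightarrow> \<exists>y. z = [y] \<and> flat sw rd y y"
    and turn: "sw e b b' a' \<Longrightarrow> rd a' a z \<Longrightarrow> sw a c c' a1 \<Longrightarrow>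
      (\<And>x. \<not> rd b a x) \<Longrightarrow> (\<And>x. \<not> rd a' c' x) \<Longrightarrow>
      (successively (flat sw rd) (b' # z @ [c]) \<and> flat sw rd b c') \<or>
      (z = [] \<and> rd b' c [] \<and> (\<exists>d. sw a' c' c d))"
    and turn_single: "sw a b b' a' \<Longrightarrow> rd a' a [] \<Longrightarrow> (\<And>x. \<not> rd b a x) \<Longrightarrow> \<not> rd b' b x"
begin

lemma push_no_sw':
  assumes "push sw a bs (xs @ [b', c'] @ ys) a'"
  shows "\<not> sw b' c' u v"
proof -
  from push_append_rightD[OF assms] obtain cs a1 where "push sw a1 cs (b' # c' # ys) a'"
    by auto
  then obtain b a2 ds where "sw a1 b b' a2" "push sw a2 ds (c' # ys) a'"
    by (cases rule: push.cases) auto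
  moreover from this(2) obtain c a3 where "sw a2 c c' a3"
    by (cases rule: push.cases) auto
  ultimately have "sw a1 b b' a2" "sw a2 c c' a3" by blast+
  then show ?thesis by (rule sw_sw')
qed

text \<open>A word \<open>v\<close> of minimal length in its conjugacy class whose powers are not all irreducible is, up
  to rotation, \<open>a bs\<close> with a strip leading from \<open>a\<close> to the next copy of \<open>a\<close>: the corresponding
  isometry is a glide reflection. The square of \<open>v\<close> then shortens to \<open>bs' z bs\<close>, which runs along one
  side of the strip.\<close>

lemma irreducible_axis:
  assumes closed: "\<And>u w. u \<in> M \<Longrightarrow> rch u w \<Longrightarrow> w \<in> M"
    and rot: "\<And>p q. p @ q \<in> M \<Longrightarrow> q @ p \<in> M"
    and v: "v \<in> M" and min: "\<And>w. w \<in> M \<Longrightarrow> length v \<le> length w"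
  shows "\<exists>x\<in>M. \<exists>u. rch (x @ x) u \<and> (\<forall>n. irreducible sw rd (concat (replicate n u)))"
proof (cases "\<forall>n. irreducible sw rd (concat (replicate n v))")
  case True
  have "concat (replicate n (v @ v)) = concat (replicate (2 * n) v)" for n
    by (induction n) auto
  with True v show ?thesis by (auto intro!: bexI[of _ v] exI[of _ "v @ v"] reach_refl)
next
  case False
  define m where "m = length v"
  have no_pat: "\<not> pat sw rd w r" if "w \<in> M" "length w = m" for w r
    using min[OF closed[OF that(1) pat_reach[of sw rd w r]]] pat_length[of w r] that(2) m_def by auto
  have no_rd: "\<not> rd c d z" if "p @ [c, d] @ q \<in> M" "length (p @ [c, d] @ q) = m" for p c d q z
    using no_pat[OF that] red1_pat[OF red1.intros[of rd c d z p q], of sw] by blast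
  \<comment> \<open>By minimality the corner from the last letter back to the first does not shorten
    either.\<close>
  have no_rd': "\<not> rd c d z" if "d # p @ [c] \<in> M" "length (d # p @ [c]) = m" for p c d z
    using rot[of "d # p" "[c]"] no_rd[of "[]" c d p z] that by simp
  from False obtain n r where "pat sw rd (concat (replicate n v)) r" by (auto simp: irreducible_def)
  then obtain p a bs y q bs' a' z where vn: "concat (replicate n v) = p @ a # bs @ y # q"
    and P: "push sw a bs bs' a'" and r: "rd a' y z" by (auto elim!: pat.cases)
  have m0: "m > 0" using vn m_def by (cases "v = []") auto
  \<comment> \<open>The rotation of \<open>v\<close> that begins where the strip begins;
    \<open>cs\<close>, the word under the strip, reads it periodically.\<close>
  define v' where "v' = rotate (length p) v"
  have v'M: "v' \<in> M" unfolding v'_def rotate_drop_take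
    by (rule rot) (use v in simp)
  have lv': "length v' = m" by (simp add: v'_def m_def)
  define cs where "cs = a # bs @ [y]"
  have cs: "cs ! j = v' ! (j mod m)" if "j < length bs + 2" for j
  proof -
    have l: "n * m = length p + (length bs + 2) + length q"
      using arg_cong[OF vn, of length] by (simp add: m_def)
    have "cs ! j = concat (replicate n v) ! (length p + j)"
      unfolding vn cs_def using that by (simp add: nth_append nth_Cons split: nat.split)
    also have "\<dots> = v ! ((length p + j) mod m)"
      using that l by (subst nth_concat_replicate) (auto simp: m_def)
    also have "\<dots> = v' ! (j mod m)"
      using m0 unfolding v'_def m_def by (subst nth_rotate) (auto simp: mod_simps)
    finally show ?thesis .
  qed
  have bs_nth: "bs ! j = cs ! Suc j" if "j < length bs" for j
    using that by (simp add: cs_def nth_append)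
  have a: "v' ! 0 = a" using cs[of 0] by (simp add: cs_def)
  have tk: "take k cs = take k v'" if "k \<le> m" "k \<le> length bs + 2" for k
    by (rule nth_equalityI) (use that lv' cs in \<open>auto simp: cs_def\<close>)
  have Sm: "Suc m mod m = 1 mod m" using mod_add_self1[of m 1] by simp
  consider "length bs + 2 \<le> m" | "length bs + 1 = m" | "length bs = m" | "length bs > m" by linarith
  then show ?thesis
  proof cases
    \<comment> \<open>The strip fits into \<open>v'\<close> and would shorten a word of minimal
      length.\<close>
    case 1
    have lc: "length cs = length bs + 2" by (simp add: cs_def)
    then have "take (length cs) v' = cs" using tk[of "length cs"] 1 by simp
    then have "v' = cs @ drop (length cs) v'" by (metis append_take_drop_id)
    then have "pat sw rd v' ([] @ bs' @ z @ drop (length cs) v')"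
      using pat.intros[of sw a bs bs' a' rd y z "[]", OF P r, of "drop (length cs) v'"]
      by (metis append_Cons append_Nil append_assoc cs_def)
    then show ?thesis using no_pat v'M lv' by blast
  next
    \<comment> \<open>The strip goes beyond a full turn, so its first corner occurs again in its
      interior, where \<open>push_no_sw\<close> forbids the flip that starts the strip.\<close>
    case 4
    have "bs ! (m - 1) = a"
      using cs[of m] bs_nth[of "m - 1"] 4 m0 a by simp
    moreover have "bs ! m = bs ! 0"
      using cs[of 1] cs[of "Suc m"] bs_nth[of m] bs_nth[of 0] 4 m0 Sm by (cases "bs = []") auto
    moreover have "bs = take (m - 1) bs @ [bs ! (m - 1), bs ! m] @ drop (Suc m) bs"
      using id_take_nth_drop[of "m - 1" bs] 4 m0 by (simp add: Cons_nth_drop_Suc)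
    ultimately have "\<not> sw a (bs ! 0) u w" for u w
      using push_no_sw[of a "take (m - 1) bs" a "bs ! 0" "drop (Suc m) bs" bs' a' u w] P by metis
    moreover obtain c bs2 where "bs = c # bs2" using 4 by (cases bs) auto
    ultimately show ?thesis using P by (auto dest: push_ConsD)
  next
    \<comment> \<open>The strip ends one letter after the next copy of \<open>a\<close>. Pushing
      \<open>a\<close> once around gives a word of minimal length whose cyclic corner
      \<open>e c'\<close> shortens by \<open>sw_rd_sw\<close>. For a one-letter word
      \<open>sw_self\<close> is needed instead.\<close>
    case 3
    then obtain bs0 b where bs: "bs = bs0 @ [b]" using m0 by (cases bs rule: rev_cases) auto
    have b: "b = a" using bs_nth[of "m - 1"] cs[of m] 3 m0 a bs by auto
    have y: "y = cs ! Suc m" using 3 by (simp add: cs_def nth_append)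
    from P obtain bs0' b' e where e: "push sw a bs0 bs0' e" "bs' = bs0' @ [b']" "sw e a b' a'"
      unfolding bs b by (auto dest!: push_appendD push_ConsD push_NilD)
    show ?thesis
    proof (cases bs0)
      case Nil
      then have "m = 1" using 3 bs by simp
      then have "y = a" using y cs[of "Suc m"] 3 a Sm by simp
      then show ?thesis using e r Nil sw_self[of a b' a' z] by (auto dest: push_NilD)
    next
      case (Cons c bs1)
      then have m2: "m \<ge> 2" using 3 bs by simp
      have yc: "y = c" using y cs[of "Suc m"] cs[of 1] 3 m2 bs Cons bs_nth[of 0] Sm by simp
      from e(1) Cons obtain c' a1 bs1' where c: "bs0' = c' # bs1'" "sw a c c' a1"
        by (auto dest: push_ConsD)
      from sw_rd_sw[OF e(3) r] yc c obtain z1 where z1: "rd e c' z1" by blast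
      have "v' = a # bs0"
        using tk[of "length (a # bs0)"] lv' 3 bs by (simp add: cs_def)
      then have "bs0' @ [e] \<in> M" using closed[OF v'M] push_reach[OF e(1), of rd] by simp
      with c have "c' # bs1' @ [e] \<in> M" by simp
      moreover have "length (c' # bs1' @ [e]) = m" using length_push[OF e(1)] c 3 bs by simp
      ultimately show ?thesis using no_rd'[of c' bs1' e z1] z1 by simp
    qed
  next
    case 2
    have v': "v' = a # bs"
      using tk[of "length (a # bs)"] lv' 2 by (simp add: cs_def)
    have "y = cs ! m" using 2 by (auto simp: cs_def nth_append)
    then have y: "y = a" using cs[of m] 2 a by simp
    have "rch ([] @ (a # bs) @ (a # bs)) ([] @ (bs' @ [a']) @ (a # bs))"
      by (rule reach_ctx[OF push_reach[OF P]])
    moreover have "red1 rd (bs' @ [a', a] @ bs) (bs' @ z @ bs)"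
      using red1.intros[of rd a' a z bs' bs] r y by simp
    ultimately have rch: "rch (v' @ v') (bs' @ z @ bs)"
      using v' reach_red[of sw rd "v' @ v'" "bs' @ [a', a] @ bs"] by simp
    have "successively (flat sw rd) ((bs' @ z @ bs) @ (bs' @ z @ bs))"
    proof (cases bs rule: rev_cases)
      case Nil
      then show ?thesis using P r y rd_self[of a z] by (auto dest!: push_NilD)
    next
      case (snoc bs0 b)
      from P obtain bs0' b' e where e: "push sw a bs0 bs0' e" "bs' = bs0' @ [b']" "sw e b b' a'"
        unfolding snoc by (auto dest!: push_appendD push_ConsD push_NilD)
      have "bs \<noteq> []" using snoc by simp
      then obtain c bs1 where c: "bs = c # bs1" by (cases bs) auto
      from P obtain c' a1 bs1' where c': "bs' = c' # bs1'" "sw a c c' a1"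
        using push_ConsD[of sw a c bs1 bs' a'] c by blast
      have rM: "bs' @ [a'] \<in> M" using closed[OF v'M] push_reach[OF P, of rd] v' by simp
      have rl: "length (bs' @ [a']) = m" using length_push[OF P] 2 by simp
      have ba: "\<not> rd b a x" for x
        using no_rd'[of a bs0 b x] v'M v' lv' snoc by simp
      have ac: "\<not> rd a' c' x" for x
        using no_rd'[of c' bs1' a' x] rM rl c' by simp
      \<comment> \<open>Otherwise flipping the cyclic corner \<open>a' c'\<close> of
        \<open>bs' @ [a']\<close> puts \<open>c\<close> after \<open>b'\<close>, and these cancel,
        against minimality. \<open>turn_single\<close> covers a strip over one letter.\<close>
      have "\<not> (z = [] \<and> rd b' c [] \<and> (\<exists>d. sw a' c' c d))"
      proof safe
        fix d assume d: "z = []" "rd b' c []" "sw a' c' c d"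
        show False
        proof (cases bs0)
          case Nil
          then have "sw a b b' a'" "c = b" using e c snoc by (auto dest: push_NilD)
          then show ?thesis using turn_single[of a b b' a' "[]"] r y d ba by simp
        next
          case (Cons f bs2)
          then have "bs0' \<noteq> []" using length_push[OF e(1)] by auto
          then obtain ws where ws: "bs0' = c' # ws" using e(2) c'(1) by (cases bs0') auto
          have "(c' # ws) @ [b', a'] \<in> M" using rM e ws by simp
          then have "[b'] @ [a', c'] @ ws \<in> M" using rot[of "c' # ws" "[b', a']"] by simp
          moreover have "swap1 sw ([b'] @ [a', c'] @ ws) ([b'] @ [c, d] @ ws)"
            using d by (intro swap1.intros)
          ultimately have "[b'] @ [c, d] @ ws \<in> M"
            using closed[OF _ reach_swap[OF reach_refl]] by blast
          then show ?thesis using no_rd[of "[]" b' c "d # ws"] d rl e ws by simp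
        qed
      qed
      with turn[OF e(3) r[unfolded y] c'(2)] ba ac
      have t: "successively (flat sw rd) (b' # z @ [c])" "flat sw rd b c'" by blast+
      \<comment> \<open>Along both sides of the strip, corners do not shorten by minimality and do
        not flip by \<open>push_no_sw\<close> and \<open>push_no_sw'\<close>.\<close>
      have s: "successively (flat sw rd) bs"
      proof (rule successivelyI)
        fix p c d q assume *: "bs = p @ [c, d] @ q"
        show "flat sw rd c d" unfolding flat_def
          using no_rd[of "a # p" c d q] v'M v' lv' * push_no_sw[of a p c d q bs' a'] P by simp
      qed
      have s': "successively (flat sw rd) bs'"
      proof (rule successivelyI)
        fix p c d q assume *: "bs' = p @ [c, d] @ q"
        show "flat sw rd c d" unfolding flat_def
          using no_rd[of p c d "q @ [a']"] rM rl * push_no_sw'[of a bs p c d q a'] P by simp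
      qed
      have lh: "last bs = b" "hd bs' = c'" "hd bs = c" "last bs' = b'" "bs \<noteq> []" "bs' \<noteq> []"
        subgoal using snoc by simp
        subgoal using c' by simp
        subgoal using c by simp
        subgoal using e by simp
        subgoal using c by simp
        subgoal using c' by simp
        done
      show ?thesis
      proof (cases z)
        case Nil
        then show ?thesis using t s s' lh by (auto simp: successively_append_iff)
      next
        case (Cons w ws)
        then show ?thesis using t s s' lh rd_length[OF r]
          by (auto simp: successively_append_iff successively_Cons)
      qed
    qed
    then have "irreducible sw rd (concat (replicate n (bs' @ z @ bs)))" for n
      by (intro flat_irreducible successively_concat_replicate)
    then show ?thesis using rch v'M by blast
  qed
qed

end

section \<open>An automaton for irreducible words\<close>

text \<open>The letters that the strips starting anywhere in \<open>w\<close> have become at the end of \<open>w\<close>.\<close>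

definition active where
  "active sw w = {a'. \<exists>p a bs bs'. w = p @ a # bs \<and> push sw a bs bs' a'}"

text \<open>\<open>None\<close> is the dead state after a strip has ended in a shortening. Every
  letter read also starts a strip of its own, hence the inserted \<open>y\<close>.\<close>

definition strip_next where
  "strip_next sw rd st y = (case st of None \<Rightarrow> None | Some T \<Rightarrow>
     if \<exists>a\<in>T. \<exists>z. rd a y z then None else Some (insert y {a'. \<exists>a\<in>T. \<exists>b. sw a y b a'}))"

lemma activeI: "push sw a bs bs' a' \<Longrightarrow> a' \<in> active sw (p @ a # bs)"
  by (auto simp: active_def)

lemma active_snoc: "active sw (w @ [y]) = insert y {a'. \<exists>a\<in>active sw w. \<exists>b. sw a y b a'}"
proof (intro equalityI subsetI)
  fix a' assume "a' \<in> active sw (w @ [y])"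
  then obtain p a bs bs' where *: "w @ [y] = p @ a # bs" "push sw a bs bs' a'"
    by (auto simp: active_def)
  show "a' \<in> insert y {a'. \<exists>a\<in>active sw w. \<exists>b. sw a y b a'}"
  proof (cases bs rule: rev_cases)
    case Nil
    then show ?thesis using * by (auto dest: push_NilD)
  next
    case (snoc bs0 b)
    then have "b = y" "w = p @ a # bs0" using *(1) by (metis append_Cons append_assoc butlast_snoc last_snoc)+
    moreover obtain bs0' a1 b' where "push sw a bs0 bs0' a1" "sw a1 b b' a'"
      using *(2) snoc by (auto dest!: push_appendD push_ConsD push_NilD)
    ultimately show ?thesis using activeI[of sw a bs0 bs0' a1 p] by auto
  qed
next
  fix a' assume "a' \<in> insert y {a'. \<exists>a\<in>active sw w. \<exists>b. sw a y b a'}"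
  then consider "a' = y" | a b where "a \<in> active sw w" "sw a y b a'" by blast
  then show "a' \<in> active sw (w @ [y])"
  proof cases
    case 1
    then show ?thesis using activeI[OF push_Nil[of sw y], of w] by simp
  next
    case 2
    then obtain p a0 bs bs' where "w = p @ a0 # bs" "push sw a0 bs bs' a" by (auto simp: active_def)
    moreover from this have "push sw a0 (bs @ [y]) (bs' @ [b]) a'"
      using 2 by (auto intro: push_append push.intros)
    ultimately show ?thesis unfolding active_def by (metis (mono_tags, lifting) append_Cons append_assoc mem_Collect_eq)
  qed
qed

text \<open>A strip that is new in \<open>w @ [y]\<close> must end at \<open>y\<close>, so of the
  past only the active letters matter. This is why finite memory suffices.\<close>

lemma irreducible_snoc:
  "irreducible sw rd (w @ [y]) \<longleftrightarrow> irreducible sw rd w \<and> (\<forall>a\<in>active sw w. \<forall>z. \<not> rd a y z)"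
proof -
  have "(\<exists>r. pat sw rd (w @ [y]) r) \<longleftrightarrow> (\<exists>r. pat sw rd w r) \<or> (\<exists>a\<in>active sw w. \<exists>z. rd a y z)"
  proof (intro iffI; elim disjE exE bexE)
    fix r assume "pat sw rd (w @ [y]) r"
    then show "(\<exists>r. pat sw rd w r) \<or> (\<exists>a\<in>active sw w. \<exists>z. rd a y z)"
    proof cases
      case (1 a bs bs' a' y' z p q)
      show ?thesis
      proof (cases q rule: rev_cases)
        case Nil
        then have "y' = y" "w = p @ a # bs" using 1(1) by (metis append_Cons append_assoc butlast_snoc last_snoc)+
        then show ?thesis using 1 activeI[of sw a bs bs' a' p] by blast
      next
        case (snoc q' x)
        then have "w = p @ a # bs @ y' # q'" using 1(1) by simp
        then show ?thesis using 1 by (auto intro: pat.intros)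
      qed
    qed
  next
    fix r assume "pat sw rd w r"
    then show "\<exists>r. pat sw rd (w @ [y]) r" using pat_ctx[of sw rd w r "[]" "[y]"] by auto
  next
    fix a z assume "a \<in> active sw w" "rd a y z"
    then obtain p a0 bs bs' where "w = p @ a0 # bs" "push sw a0 bs bs' a" by (auto simp: active_def)
    with \<open>rd a y z\<close> pat.intros[of sw a0 bs bs' a rd y z p "[]"] show "\<exists>r. pat sw rd (w @ [y]) r"
      by auto
  qed
  then show ?thesis by (auto simp: irreducible_def)
qed

lemma foldl_strip_next:
  "foldl (strip_next sw rd) (Some {}) w = (if irreducible sw rd w then Some (active sw w) else None)"
proof (induction w rule: rev_induct)
  case Nil
  have "irreducible sw rd []" by (auto simp: irreducible_def elim: pat.cases)
  then show ?case by (auto simp: active_def)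
next
  case (snoc y w)
  then show ?case by (auto simp: irreducible_snoc active_snoc strip_next_def)
qed

text \<open>\<open>regular_language\<close> fixes natural numbers as states; a finite state set of
  any type is transferred along an injection.\<close>

lemma regular_languageI:
  fixes d :: "'q \<Rightarrow> 'x \<Rightarrow> 'q"
  assumes "finite A" "finite Q" "q0 \<in> Q" "\<And>q a. q \<in> Q \<Longrightarrow> a \<in> A \<Longrightarrow> d q a \<in> Q"
    and L: "L = {xs \<in> lists A. foldl d q0 xs \<in> F}"
  shows "regular_language A L"
proof -
  obtain f :: "'q \<Rightarrow> nat" where f: "inj_on f Q"
    using finite_imp_inj_to_nat_seg[OF assms(2)] by blast
  define g where "g = inv_into Q f"
  have g: "g (f q) = q" if "q \<in> Q" for q using f that by (simp add: g_def)
  define d' where "d' n a = f (d (g n) a)" for n a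
  have run: "foldl d q xs \<in> Q \<and> foldl d' (f q) xs = f (foldl d q xs)" if "xs \<in> lists A" "q \<in> Q" for xs q
    using that by (induction xs arbitrary: q) (auto simp: d'_def g assms)
  have "L = {xs \<in> lists A. foldl d' (f q0) xs \<in> f ` (F \<inter> Q)}"
    unfolding L using run[OF _ assms(3)] inj_on_image_mem_iff[OF f, of "foldl d q0 _" "F \<inter> Q"]
    by (intro Collect_cong) (metis IntE IntI inf_le2)
  moreover have "f ` (F \<inter> Q) \<subseteq> f ` Q" "f q0 \<in> f ` Q" "\<forall>q\<in>f ` Q. \<forall>a\<in>A. d' q a \<in> f ` Q"
    using assms by (auto simp: d'_def g)
  ultimately show ?thesis unfolding regular_language_def using assms(1,2) by blast
qed

lemma regular_irreducible:
  fixes L :: "'l set" and c :: "'l \<Rightarrow> 'x"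
  assumes fin: "finite L" and inj: "inj_on c L"
    and closed: "\<And>a b b' a'. a \<in> L \<Longrightarrow> b \<in> L \<Longrightarrow> sw a b b' a' \<Longrightarrow> a' \<in> L"
  shows "regular_language (c ` L) (map c ` {w \<in> lists L. irreducible sw rd w})"
proof (rule regular_languageI)
  let ?d = "\<lambda>q x. strip_next sw rd q (inv_into L c x)"
  have run: "foldl ?d q (map c w) = foldl (strip_next sw rd) q w" if "w \<in> lists L" for w q
    using that by (induction w arbitrary: q) (auto simp: inj)
  have acc: "foldl ?d (Some {}) (map c w) \<noteq> None \<longleftrightarrow> irreducible sw rd w" if "w \<in> lists L" for w
    using run[OF that] by (simp add: foldl_strip_next)
  have "{xs \<in> lists (c ` L). foldl ?d (Some {}) xs \<in> - {None}} =
      map c ` {w \<in> lists L. foldl ?d (Some {}) (map c w) \<noteq> None}"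
    unfolding lists_image Compr_image_eq by simp
  also have "{w \<in> lists L. foldl ?d (Some {}) (map c w) \<noteq> None} = {w \<in> lists L. irreducible sw rd w}"
    using acc by blast
  finally show "map c ` {w \<in> lists L. irreducible sw rd w} =
      {xs \<in> lists (c ` L). foldl ?d (Some {}) xs \<in> - {None}}" by (rule HOL.sym)
  show "finite (insert None (Some ` Pow L))" using fin by simp
  fix q x assume q: "q \<in> insert None (Some ` Pow L)" and "x \<in> c ` L"
  then obtain y where y: "y \<in> L" "inv_into L c x = y" using inj by auto
  show "?d q x \<in> insert None (Some ` Pow L)"
  proof (cases q)
    case None
    then show ?thesis by (simp add: strip_next_def)
  next
    case (Some T)
    with q have "T \<subseteq> L" by auto
    then have "insert y {a'. \<exists>a\<in>T. \<exists>b. sw a y b a'} \<subseteq> L" using y(1) closed by blast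
    then show ?thesis using Some y(2) by (simp add: strip_next_def)
  qed
qed (use fin in auto)

section \<open>Square and triangle complexes\<close>

lemma linv_linv [simp]: "linv (linv x) = x"
  by (simp add: linv_def)

lemma linv_neq [simp]: "linv x \<noteq> x" "x \<noteq> linv x"
  by (simp_all add: linv_def prod_eq_iff)

lemma linv_inject [simp]: "linv x = linv y \<longleftrightarrow> x = y"
  by (metis linv_linv)

lemma conn_redI: "rd a b z \<Longrightarrow> conn sw rd 2 [a, b] z"
  using conn_red[OF red1.intros[of rd a b z "[]" "[]"], of 2 sw] by simp

lemma conn_swapI: "sw a b c d \<Longrightarrow> conn sw rd 2 [a, b] [c, d]"
  using conn_swap[OF swap1.intros[of sw a b c d "[]" "[]"], of 2 rd] by simp

text \<open>A square with the corner \<open>linv x\<close> followed by \<open>y\<close> is an edge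
  from \<open>x\<close> to \<open>y\<close> in the link of a vertex. Thus \<open>nocancel\<close>
  excludes loops, \<open>unique\<close> double edges, and \<open>no_triangle\<close> cycles of
  length three.\<close>

locale squares =
  fixes Sq :: "'a letter \<Rightarrow> 'a letter \<Rightarrow> 'a letter \<Rightarrow> 'a letter \<Rightarrow> bool"
  assumes rot: "Sq a b c d \<Longrightarrow> Sq b c d a"
    and inverse: "Sq a b c d \<Longrightarrow> Sq (linv d) (linv c) (linv b) (linv a)"
    and nocancel: "Sq a b c d \<Longrightarrow> b \<noteq> linv a"
    and unique: "Sq a b c d \<Longrightarrow> Sq a b c' d' \<Longrightarrow> c' = c \<and> d' = d"
    and no_power: "\<not> Sq a b a b"
    and no_triangle: "Sq (linv x) y c1 d1 \<Longrightarrow> Sq (linv y) z c2 d2 \<Longrightarrow> \<not> Sq (linv z) x c3 d3"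
begin

definition sw where "sw a b c d \<longleftrightarrow> Sq a b (linv d) (linv c)"
definition rd where "rd a b z \<longleftrightarrow> b = linv a \<and> z = ([] :: 'a letter list)"

text \<open>The same square read from each of its corners and in both directions.\<close>

lemma flip:
  assumes "sw a b c d"
  shows "sw c d a b" "sw (linv a) c b (linv d)" "sw b (linv d) (linv a) c" "sw (linv d) (linv c) (linv b) (linv a)"
    "sw (linv c) a d (linv b)" "sw d (linv b) (linv c) a" "sw (linv b) (linv a) (linv d) (linv c)"
proof -
  have 0: "Sq a b (linv d) (linv c)" using assms by (simp add: sw_def)
  note 1 = rot[OF 0] and i0 = inverse[OF 0]
  note 2 = rot[OF 1] and i1 = rot[OF i0]
  note 3 = rot[OF 2] and i2 = rot[OF i1]
  note i3 = rot[OF i2]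
  show "sw c d a b" "sw (linv a) c b (linv d)" "sw b (linv d) (linv a) c" "sw (linv d) (linv c) (linv b) (linv a)"
    "sw (linv c) a d (linv b)" "sw d (linv b) (linv c) a" "sw (linv b) (linv a) (linv d) (linv c)"
    using 0 1 2 3 i0 i1 i2 i3 by (simp_all add: sw_def)
qed

lemma sw_unique: "sw a b c d \<Longrightarrow> sw a b c' d' \<Longrightarrow> c' = c \<and> d' = d"
  unfolding sw_def using unique by fastforce

lemma sw_nocancel:
  assumes "sw a b c d" shows "b \<noteq> linv a" "d \<noteq> b" "c \<noteq> a" "d \<noteq> linv c"
  using nocancel[of a b] nocancel[of b "linv d"] nocancel[of "linv c" a] nocancel[of c d] flip[OF assms] assms
  unfolding sw_def by (metis linv_linv)+

lemma no_link_triangle: "sw (linv x) y c1 d1 \<Longrightarrow> sw (linv y) z c2 d2 \<Longrightarrow> \<not> sw (linv z) x c3 d3"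
  unfolding sw_def by (rule no_triangle)

lemma sw_no_power: "\<not> sw a b (linv b) (linv a)"
  using no_power by (simp add: sw_def)

sublocale flip_axis_system sw rd
proof unfold_locales
  fix a b c d u v x y z z' b' a' c' a'' a1 b1 y1 e z1 c2 d2
  show "sw a b c d \<Longrightarrow> sw c d a b" by (rule flip)
  show "sw a b c d \<Longrightarrow> sw a b c' d2 \<Longrightarrow> c' = c \<and> d2 = d" by (rule sw_unique)
  show "rd a b z \<Longrightarrow> rd a b z' \<Longrightarrow> z' = z" by (simp add: rd_def)
  show "rd a b z \<Longrightarrow> length z \<le> 1" by (simp add: rd_def)
  show "sw a b c d \<Longrightarrow> \<not> rd a b z" using sw_nocancel by (auto simp: rd_def)
  show "rd a b z \<Longrightarrow> rd b c z' \<Longrightarrow> conn sw rd 2 (z @ [c]) (a # z')"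
    by (auto simp: rd_def intro: conn_refl)
  show "(\<exists>z'. rd a c' z' \<and> conn sw rd 2 (z' @ [b']) (z @ [c])) \<or>
      (\<exists>c2 a2 z2. sw a c' c2 a2 \<and> rd a2 b' z2 \<and> conn sw rd 2 (c2 # z2) (z @ [c]))"
    if "rd a b z" "sw b c c' b'"
  proof -
    \<comment> \<open>The cancelling edge \<open>a\<close> is a side of the flipped square, so after
      the flip \<open>a\<close> slides over \<open>c'\<close> and then cancels against
      \<open>b'\<close>.\<close>
    have "sw a c' c (linv b')" using flip(2)[OF that(2)] that(1) by (simp add: rd_def)
    then show ?thesis using that
      by (intro disjI2 exI[of _ c] exI[of _ "linv b'"] exI[of _ "[]"]) (simp add: rd_def conn_refl)
  qed
  show "\<exists>e q z2. length q \<le> 1 \<and> conn sw rd 2 [d, b'] (q @ [e]) \<and> rd e a1 z2 \<and> conn sw rd 2 (q @ z2) (z1 @ [b])"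
    if "rd d a z1" "sw a b b' a1"
  proof -
    have "sw d b' b (linv a1)" using flip(2)[OF that(2)] that(1) by (simp add: rd_def)
    then show ?thesis using that
      by (intro exI[of _ "linv a1"] exI[of _ "[b]"] exI[of _ "[]"]) (auto simp: rd_def intro: conn_refl conn_swapI)
  qed
  show "\<exists>z1. rd a y1 z1 \<and> conn sw rd 2 (z1 @ [b1]) (b' # z)"
    if "sw a b b' a'" "rd a' y z" "sw b y y1 b1"
  proof -
    have "y1 = linv a \<and> b1 = b'"
      using sw_unique[OF flip(3)[OF that(1)]] that by (simp add: rd_def)
    then show ?thesis using that by (auto simp: rd_def intro: conn_refl)
  qed
  show "conn sw rd 2 (b' # z') (a # z)" if "sw a b b' a'" "rd a' y z'" "rd b y z"
    using that sw_nocancel(2)[OF that(1)] by (simp add: rd_def)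
  \<comment> \<open>The three squares would form a triangle on \<open>linv b\<close>,
    \<open>linv a'\<close> and \<open>c\<close> in the link.\<close>
  show "\<not> sw b c u v" if "sw a b b' a'" "sw a' c c' a''"
    using no_link_triangle[of "linv b" "linv a'" _ _ c] flip(3)[OF that(1)] that(2) flip(6) 
    by (metis linv_linv flip(7))
  show "\<exists>z'. rd b' c' z' \<and> conn sw rd 2 (a # z) (z' @ [a''])"
    if "sw a b b' a'" "sw a' c c' a''" "rd b c z"
  proof -
    have "c' = linv b' \<and> a'' = a"
      using sw_unique[OF flip(6)[OF that(1)]] that by (simp add: rd_def)
    then show ?thesis using that by (auto simp: rd_def intro: conn_refl)
  qed
  show "\<not> sw b' c' u v" if "sw a b b' a'" "sw a' c c' a''"
    using no_link_triangle[of "linv b'" "a'" _ _ c'] flip[OF that(1)] flip[OF that(2)] 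
    by (metis linv_linv flip(7))
  show "\<not> rd c a z" if "sw a a b c"
  proof
    assume "rd c a z"
    then have c: "linv c = a" "c = linv a" by (auto simp: rd_def)
    \<comment> \<open>Uniqueness forces \<open>b = linv a\<close>, so the relator would be the
      fourth power of \<open>a\<close>.\<close>
    have "sw a a (linv a) b" using flip(3)[OF that] c(1) by simp
    then have "b = linv a" using sw_unique[OF that] by blast
    then show False using sw_no_power[of a] that c(2) by simp
  qed
  show "rd a a z \<Longrightarrow> \<exists>y. z = [y] \<and> flat sw rd y y"
    by (simp add: rd_def)
  show "successively (flat sw rd) (b' # z @ [c]) \<and> flat sw rd b c' \<or>
      z = [] \<and> rd b' c [] \<and> (\<exists>d. sw a' c' c d)"
    if "sw e b b' a'" "rd a' a z" "sw a c c' a1"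
  proof -
    have z: "z = []" "a' = linv a" using that(2) by (simp_all add: rd_def)
    note s = that(1)[unfolded z(2)] flip[OF that(1)[unfolded z(2)]] that(3) flip[OF that(3)]
    \<comment> \<open>\<open>linv b'\<close> and \<open>c\<close> have the common neighbour
      \<open>linv a\<close> in the link, so a square at the corner \<open>b' c\<close> would close a
      triangle. The corner \<open>b c'\<close> is treated alike, through \<open>a\<close>.\<close>
    have "\<not> sw b' c u v" for u v
      using no_link_triangle[of "linv b'" "linv a" _ _ c] s
      by (metis linv_linv flip(7))
    moreover have "\<not> sw b c' u v" for u v
      using no_link_triangle[of "linv b" "a" _ _ c'] s
      by (metis linv_linv flip(7))
    moreover have "c' = linv b \<Longrightarrow> c = linv b'"
      using s sw_unique by (metis linv_linv)
    moreover have "\<exists>d. sw a' c' c d" using s z by blast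
    ultimately show ?thesis using z unfolding flat_def rd_def by (cases "c = linv b'") auto
  qed
  show "\<not> rd b' b x" if "sw a b b' a'" "rd a' a []"
    using that sw_no_power[of a b] by (auto simp: rd_def)
qed

end

text \<open>\<open>Tr a b c\<close> says that \<open>a b c\<^sup>-\<^sup>1\<close> is a relator. The last three conditions exclude cycles of length three,
  four and five in the link.\<close>

locale triangles =
  fixes Tr :: "'a letter \<Rightarrow> 'a letter \<Rightarrow> 'a letter \<Rightarrow> bool"
  assumes left: "Tr a b c \<Longrightarrow> Tr (linv a) c b"
    and right: "Tr a b c \<Longrightarrow> Tr c (linv b) a"
    and nocancel: "Tr a b c \<Longrightarrow> b \<noteq> linv a"
    and unique: "Tr a b c \<Longrightarrow> Tr a b c' \<Longrightarrow> c' = c"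
    and no_power: "\<not> Tr a a (linv a)"
    and link3: "Tr (linv x) y c1 \<Longrightarrow> Tr (linv y) z c2 \<Longrightarrow> \<not> Tr (linv z) x c3"
    and link4: "Tr (linv x) y c1 \<Longrightarrow> Tr (linv y) z c2 \<Longrightarrow> Tr (linv z) w c3 \<Longrightarrow> Tr (linv w) x c4 \<Longrightarrow>
      x = z \<or> y = w"
    and link5: "Tr (linv x) y c1 \<Longrightarrow> Tr (linv y) z c2 \<Longrightarrow> Tr (linv z) w c3 \<Longrightarrow> Tr (linv w) v c4 \<Longrightarrow>
      \<not> Tr (linv v) x c5"
begin

text \<open>Edges of the link of a vertex, whose vertices are the letters leaving that vertex.\<close>

definition lk where "lk x y \<longleftrightarrow> (\<exists>c. Tr (linv x) y c)"
definition sw where "sw a b c d \<longleftrightarrow> b \<noteq> linv a \<and> (\<exists>t. Tr a t c \<and> Tr t d b)"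
definition rd where "rd a b z \<longleftrightarrow> b = linv a \<and> z = [] \<or> (\<exists>c. z = [c] \<and> Tr a b c)"

lemma all_forms:
  assumes "Tr a b c"
  shows "Tr (linv a) c b" "Tr c (linv b) a" "Tr (linv b) (linv a) (linv c)" "Tr b (linv c) (linv a)"
    "Tr (linv c) a (linv b)"
proof -
  note l = left[OF assms] and r = right[OF assms]
  note lr = right[OF l] and rl = left[OF r]
  note lrl = left[OF lr]
  show "Tr (linv a) c b" "Tr c (linv b) a" "Tr (linv b) (linv a) (linv c)" "Tr b (linv c) (linv a)"
    "Tr (linv c) a (linv b)"
    using l r lr rl lrl by simp_all
qed

lemma lkI: "Tr a b c \<Longrightarrow> lk (linv a) b" "Tr a b c \<Longrightarrow> lk b (linv a)"
  "Tr a b c \<Longrightarrow> lk a c" "Tr a b c \<Longrightarrow> lk c a" "Tr a b c \<Longrightarrow> lk (linv c) (linv b)" "Tr a b c \<Longrightarrow> lk (linv b) (linv c)"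
  unfolding lk_def by (metis all_forms linv_linv)+

lemma lk_sym: "lk x y \<Longrightarrow> lk y x"
  unfolding lk_def by (metis all_forms linv_linv)

lemma lk_irrefl: "\<not> lk x x"
  using nocancel unfolding lk_def by (metis linv_linv)

lemma lk3: "lk x y \<Longrightarrow> lk y z \<Longrightarrow> \<not> lk x z"
  using link3 lk_sym unfolding lk_def by metis

lemma lk4: "lk x y \<Longrightarrow> lk y z \<Longrightarrow> lk z w \<Longrightarrow> lk x w \<Longrightarrow> x = z \<or> y = w"
  using link4 lk_sym unfolding lk_def by metis

lemma lk5: "lk x y \<Longrightarrow> lk y z \<Longrightarrow> lk z w \<Longrightarrow> lk w v \<Longrightarrow> \<not> lk x v"
  using link5 lk_sym unfolding lk_def by metis

text \<open>A second midpoint would give a cycle of length four. Hence the edge shared by the two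
  triangles of a flip is determined.\<close>

lemma lk_path2: "lk x y \<Longrightarrow> lk y z \<Longrightarrow> lk x y' \<Longrightarrow> lk y' z \<Longrightarrow> x \<noteq> z \<Longrightarrow> y' = y"
  using lk4[of x y z y'] lk_sym by blast

lemma unique_third: "Tr a b c \<Longrightarrow> Tr a b' c \<Longrightarrow> b' = b" "Tr a b c \<Longrightarrow> Tr a' b c \<Longrightarrow> a' = a"
  by (metis all_forms(1) unique, metis all_forms(2) unique)

lemma sw_lk: "sw a b c d \<Longrightarrow> \<exists>t. Tr a t c \<and> Tr t d b \<and> lk (linv a) t \<and> lk t b \<and> b \<noteq> linv a"
  unfolding sw_def using lkI by blast

lemma rd_lk: "rd a b z \<Longrightarrow> b = linv a \<or> lk (linv a) b"
  unfolding rd_def using lkI by blast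

text \<open>A shorter path in the link from \<open>linv a\<close> to \<open>d\<close> would close up to a cycle of length at most five.\<close>

lemma flatI:
  assumes "lk (linv a) x" "lk x y" "lk y d" "linv a \<noteq> y" "x \<noteq> d"
  shows "flat sw rd a d"
  using assms sw_lk[of a d] rd_lk[of a d] lk5[of "linv a" x y d] lk4[of "linv a" x y d] lk3[of "linv a" x y] lk_sym
  unfolding flat_def by metis

sublocale flip_axis_system sw rd
proof unfold_locales
  fix a b c d u v x y z z' b' a' c' a'' a1 b1 y1 e z1 c2 d2
  show "sw c d a b" if H: "sw a b c d"
  proof -
    from H obtain t where t: "Tr a t c" "Tr t d b" "b \<noteq> linv a" by (auto simp: sw_def)
    have "d \<noteq> linv c"
      using all_forms[OF t(1)] t unique by metis
    then show ?thesis unfolding sw_def using all_forms[OF t(1)] all_forms[OF t(2)] by blast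
  qed
  show "sw a b c d \<Longrightarrow> sw a b c' d2 \<Longrightarrow> c' = c \<and> d2 = d"
    using sw_lk[of a b] lk_path2 unique unique_third by metis
  show "rd a b z \<Longrightarrow> rd a b z' \<Longrightarrow> z' = z"
    using nocancel unique unfolding rd_def by blast
  show "rd a b z \<Longrightarrow> length z \<le> 1" by (auto simp: rd_def)
  show "sw a b c d \<Longrightarrow> \<not> rd a b z" using sw_lk rd_lk lk3 by metis
  show "conn sw rd 2 (z @ [c]) (a # z')" if H: "rd a b z" "rd b c z'"
  proof -
    consider "b = linv a" "z = []" "c = linv b" "z' = []" 
      | c2 where "b = linv a" "z = []" "z' = [c2]" "Tr b c c2"
      | c1 where "z = [c1]" "Tr a b c1" "c = linv b" "z' = []"
      | c1 c2 where "z = [c1]" "Tr a b c1" "z' = [c2]" "Tr b c c2"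
      using H unfolding rd_def by blast
    then show ?thesis
    proof cases
      case 1
      then show ?thesis by (simp add: conn_refl)
    next
      case 2
      then have "rd a c2 [c]" using all_forms[OF 2(4)] by (simp add: rd_def)
      then show ?thesis using 2 by (auto intro: conn_sym conn_redI)
    next
      case 3
      then have "rd c1 c [a]" using all_forms[OF 3(2)] by (simp add: rd_def)
      then show ?thesis using 3 by (auto intro: conn_redI)
    next
      \<comment> \<open>Both triangles contain the edge \<open>b\<close>, so together they flip
        \<open>c1 c\<close> to \<open>a c2\<close>, unless both of these corners cancel.\<close>
      case 4
      show ?thesis
      proof (cases "c = linv c1")
        case True
        then have "c2 = linv a" using all_forms[OF 4(2)] 4 unique by metis
        then have "rd a c2 []" "rd c1 c []" using True by (auto simp: rd_def)
        then show ?thesis using 4 conn_redI conn_sym conn_trans by (metis append_Cons append_Nil)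
      next
        case False
        then have "sw c1 c a c2" unfolding sw_def using all_forms[OF 4(2)] all_forms[OF 4(4)] by blast
        then show ?thesis using 4 by (auto intro: conn_swapI)
      qed
    qed
  qed
  show "(\<exists>z'. rd a c' z' \<and> conn sw rd 2 (z' @ [b']) (z @ [c])) \<or>
      (\<exists>c2 a2 z2. sw a c' c2 a2 \<and> rd a2 b' z2 \<and> conn sw rd 2 (c2 # z2) (z @ [c]))"
    if H: "rd a b z" "sw b c c' b'"
  proof -
    obtain t where t: "Tr b t c'" "Tr t b' c" "c \<noteq> linv b" using H(2) by (auto simp: sw_def)
    consider "b = linv a" "z = []" | c1 where "z = [c1]" "Tr a b c1"
      using H(1) unfolding rd_def by blast
    then show ?thesis
    proof cases
      case 1
      then have "rd a c' [t]" "rd t b' [c]" using all_forms[OF t(1)] t by (auto simp: rd_def)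
      then have "rd a c' [t] \<and> conn sw rd 2 ([t] @ [b']) (z @ [c])" using 1 by (auto intro: conn_redI)
      then show ?thesis by blast
    next
      case 2
      show ?thesis
      proof (cases "c' = linv a")
        case True
        then have t': "t = linv c1" using all_forms[OF 2(2)] t unique_third by metis
        have "rd a c' []" "rd c1 c [b']" using True t' all_forms[OF t(2)] by (auto simp: rd_def)
        then have "rd a c' [] \<and> conn sw rd 2 ([] @ [b']) (z @ [c])" using 2 by (auto intro: conn_sym conn_redI)
        then show ?thesis by blast
      next
        case False
        then have "sw a c' c1 t" "rd t b' [c]" unfolding sw_def rd_def using t 2 by blast+
        then have "sw a c' c1 t \<and> rd t b' [c] \<and> conn sw rd 2 (c1 # [c]) (z @ [c])"
          using 2 by (simp add: conn_refl)
        then show ?thesis by blast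
      qed
    qed
  qed
  show "\<exists>e q z2. length q \<le> 1 \<and> conn sw rd 2 [d, b'] (q @ [e]) \<and> rd e a1 z2 \<and> conn sw rd 2 (q @ z2) (z1 @ [b])"
    if H: "rd d a z1" "sw a b b' a1"
  proof -
    obtain t where t: "Tr a t b'" "Tr t a1 b" "b \<noteq> linv a" using H(2) by (auto simp: sw_def)
    have r: "rd t a1 [b]" using t by (simp add: rd_def)
    have "length z1 \<le> 1 \<and> conn sw rd 2 [d, b'] (z1 @ [t])"
    proof -
      consider "a = linv d" "z1 = []" | c1 where "z1 = [c1]" "Tr d a c1"
        using H(1) unfolding rd_def by blast
      then show ?thesis
      proof cases
        case 1
        then have "rd d b' [t]" using all_forms[OF t(1)] by (simp add: rd_def)
        then show ?thesis using 1 by (auto intro: conn_redI)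
      next
        case 2
        show ?thesis
        proof (cases "b' = linv d")
          case True
          then have "c1 = linv t" using all_forms[OF 2(2)] t unique_third unique linv_linv by metis
          then have "rd c1 t []" "rd d b' []" using True by (auto simp: rd_def)
          then show ?thesis using 2 conn_redI conn_sym conn_trans by (metis append_Cons append_Nil length_Cons list.size(3) One_nat_def order_refl)
        next
          case False
          then have "sw d b' c1 t" unfolding sw_def using 2 t by blast
          then show ?thesis using 2 by (auto intro: conn_swapI)
        qed
      qed
    qed
    then show ?thesis using r conn_refl by blast
  qed
  show "\<exists>z1. rd a y1 z1 \<and> conn sw rd 2 (z1 @ [b1]) (b' # z)"
    if H: "sw a b b' a'" "rd a' y z" "sw b y y1 b1"
  proof -
    obtain t where t: "Tr a t b'" "Tr t a' b" using H(1) by (auto simp: sw_def)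
    obtain t2 where t2: "Tr b t2 y1" "Tr t2 b1 y" "lk (linv b) t2" "lk t2 y" "y \<noteq> linv b"
      using sw_lk[OF H(3)] by blast
    have l: "lk (linv b) (linv a')" using lkI t(2) by blast
    then have "y \<noteq> linv a'" using lk3 t2 by blast
    then obtain c1 where c1: "z = [c1]" "Tr a' y c1" using H(2) by (auto simp: rd_def)
    \<comment> \<open>Two paths of length two in the link from \<open>linv b\<close> to
      \<open>y\<close> coincide, so the edge shared by the triangles of the second flip is
      \<open>a'\<close> reversed.\<close>
    have "t2 = linv a'" using lk_path2[OF t2(3,4) l] lkI[OF c1(2)] t2(5) by metis
    then have "y1 = t" "b1 = c1" using t2 all_forms[OF t(2)] all_forms[OF c1(2)] unique unique_third by metis+
    then have "rd a y1 [b']" "conn sw rd 2 ([b'] @ [b1]) (b' # z)" using t c1 by (auto simp: rd_def intro: conn_refl)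
    then show ?thesis by blast
  qed
  show "conn sw rd 2 (b' # z') (a # z)" if H: "sw a b b' a'" "rd a' y z'" "rd b y z"
  proof -
    obtain t where t: "Tr a t b'" "Tr t a' b" using H(1) by (auto simp: sw_def)
    have l: "lk (linv b) (linv a')" using lkI t(2) by blast
    consider "y = linv a'" "z' = []" | "y = linv b" | "y \<noteq> linv a'" "y \<noteq> linv b" using H(2)
      using nocancel unfolding rd_def by blast
    then show ?thesis
    proof cases
      case 1
      have "y \<noteq> linv b" using 1 l lk_irrefl by metis
      then obtain c1 where "z = [c1]" "Tr b y c1" using H(3) by (auto simp: rd_def)
      then have "z = [t]" using 1 all_forms[OF t(2)] unique by metis
      then show ?thesis using 1 t by (auto intro!: conn_sym[OF conn_redI] simp: rd_def)
    next
      case 2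
      then have z: "z = []" using H(3) nocancel unfolding rd_def by blast
      have "y \<noteq> linv a'" using 2 l lk_irrefl by metis
      then obtain c1 where "z' = [c1]" "Tr a' y c1" using H(2) by (auto simp: rd_def)
      then have "z' = [linv t]" using 2 all_forms[OF t(2)] unique by metis
      moreover have "rd b' (linv t) [a]" using all_forms[OF t(1)] by (simp add: rd_def)
      ultimately show ?thesis using z by (auto intro: conn_redI)
    next
      case 3
      then show ?thesis using rd_lk H(2,3) l lk3 by metis
    qed
  qed
  show "\<not> sw b c u v" if H: "sw a b b' a'" "sw a' c c' a''"
  proof
    assume "sw b c u v"
    obtain t where t: "Tr t a' b" using H(1) by (auto simp: sw_def)
    then have "lk (linv b) (linv a')" using lkI by blast
    \<comment> \<open>The strip gives a link path of length three from \<open>linv b\<close> to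
      \<open>c\<close>; a flip of \<open>b c\<close> adds one of length two and closes a cycle of
      length five.\<close>
    then show False using sw_lk[OF H(2)] sw_lk[OF \<open>sw b c u v\<close>] lk5 lk_sym by metis
  qed
  show "\<exists>z'. rd b' c' z' \<and> conn sw rd 2 (a # z) (z' @ [a''])"
    if H: "sw a b b' a'" "sw a' c c' a''" "rd b c z"
  proof -
    obtain t where t: "Tr a t b'" "Tr t a' b" using H(1) by (auto simp: sw_def)
    obtain t2 where t2: "Tr a' t2 c'" "Tr t2 a'' c" "lk (linv a') t2" "lk t2 c" "c \<noteq> linv a'"
      using sw_lk[OF H(2)] by blast
    have l: "lk (linv b) (linv a')" using lkI t(2) by blast
    then have "c \<noteq> linv b" using t2 lk3 lk_sym by metis
    then obtain c1 where c1: "z = [c1]" "Tr b c c1" using H(3) by (auto simp: rd_def)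
    have "t2 = linv b" using lk4[OF l t2(3,4)] lkI[OF c1(2)] t2(5) by metis
    then have "c' = linv t" "a'' = c1" using t2 all_forms[OF t(2)] all_forms[OF c1(2)] unique unique_third by metis+
    moreover have "rd b' (linv t) [a]" using all_forms[OF t(1)] by (simp add: rd_def)
    ultimately show ?thesis using c1 by (intro exI[of _ "[a]"]) (simp add: conn_refl)
  qed
  show "\<not> sw b' c' u v" if H: "sw a b b' a'" "sw a' c c' a''"
  proof
    assume "sw b' c' u v"
    obtain t where t: "Tr a t b'" "Tr t a' b" using H(1) by (auto simp: sw_def)
    obtain t2 where t2: "Tr a' t2 c'" using H(2) by (auto simp: sw_def)
    \<comment> \<open>On the far side of the strip, too, the corner spans three triangles, and a
      flip would close a cycle of length five.\<close>
    have "lk (linv b') (linv t)" "lk (linv t) a'" "lk a' c'" using lkI t t2 by blast+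
    then show False using sw_lk[OF \<open>sw b' c' u v\<close>] lk5 lk_sym by metis
  qed
  show "\<not> rd c a z" if H: "sw a a b c"
  proof
    assume r: "rd c a z"
    obtain t where t: "Tr a t b" "Tr t c a" "lk (linv a) t" "lk t a" "a \<noteq> linv a"
      using sw_lk[OF H] by blast
    have l: "lk (linv a) (linv c)" using lkI t(2) by blast
    show False
    proof (cases "a = linv c")
      case True
      then show ?thesis using l t lk3 by metis
    next
      case False
      then have "lk (linv c) a" using rd_lk[OF r] by blast
      then have "t = linv c" using lk_path2[OF l _ t(3,4)] t(5) by metis
      then show ?thesis using nocancel[OF t(2)] by simp
    qed
  qed
  show "\<exists>y. z = [y] \<and> flat sw rd y y" if H: "rd a a z"
  proof -
    obtain y where y: "z = [y]" "Tr a a y" using H by (auto simp: rd_def)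
    have "lk (linv y) (linv a)" "lk (linv a) a" "lk a y" using lkI[OF y(2)] by blast+
    moreover have "linv y \<noteq> a" "linv a \<noteq> y" using no_power y(2) by (metis linv_linv)+
    ultimately show ?thesis using y(1) flatI by blast
  qed
  show "successively (flat sw rd) (b' # z @ [c]) \<and> flat sw rd b c' \<or>
      z = [] \<and> rd b' c [] \<and> (\<exists>d. sw a' c' c d)"
    if H: "sw e b b' a'" "rd a' a z" "sw a c c' a1" and ba: "\<And>x. \<not> rd b a x" and ac: "\<And>x. \<not> rd a' c' x"
  proof -
    obtain t where t: "Tr e t b'" "Tr t a' b" "b \<noteq> linv e" using H(1) by (auto simp: sw_def)
    obtain t2 where t2: "Tr a t2 c'" "Tr t2 a1 c" "c \<noteq> linv a" using H(3) by (auto simp: sw_def)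
    have ne: "a \<noteq> linv a'" "a \<noteq> linv b" "c' \<noteq> linv a'"
      using ba[of "[t]"] ba[of "[]"] ac[of "[]"] all_forms[OF t(2)] by (auto simp: rd_def)
    then obtain w where w: "z = [w]" "Tr a' a w" using H(2) by (auto simp: rd_def)
    have "linv b' \<noteq> a'"
      using t all_forms[OF t(1)] unique by (metis linv_linv)
    moreover have "linv t \<noteq> w" using all_forms[OF t(2)] w ne unique_third by metis
    \<comment> \<open>Each of the three corners spans three triangles, as \<open>flatI\<close>
      requires; one of them is always the triangle of the shortening of \<open>a' a\<close> to
      \<open>w\<close>.\<close>
    ultimately have "flat sw rd b' w"
      using flatI[of b' "linv t" a' w] lkI[OF t(1)] lkI[OF t(2)] lkI[OF w(2)] by blast
    moreover have "linv w \<noteq> t2" using all_forms[OF w(2)] t2 ne unique by metis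
    then have "flat sw rd w c"
      using flatI[of w "linv a" t2 c] lkI[OF w(2)] lkI[OF t2(1)] lkI[OF t2(2)] t2(3) by metis
    moreover have "flat sw rd b c'"
      using flatI[of b "linv a'" a c'] lkI[OF t(2)] lkI[OF w(2)] lkI[OF t2(1)] ne by metis
    ultimately show ?thesis using w by simp
  qed
  show "\<not> rd b' b x" if H: "sw a b b' a'" "rd a' a []" "\<And>x. \<not> rd b a x"
  proof -
    obtain t where t: "Tr t a' b" using H(1) by (auto simp: sw_def)
    have "a = linv a'" using H(2) by (simp add: rd_def)
    \<comment> \<open>The triangle on \<open>t\<close>, \<open>a'\<close>, \<open>b\<close>, read
      from \<open>b\<close>, shortens \<open>b a\<close> to \<open>t\<close>, which is
      excluded.\<close>
    then show ?thesis using H(3)[of "[t]"] all_forms[OF t] by (simp add: rd_def)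
  qed
qed

end

section \<open>The presented group\<close>

lemma winv_simps [simp]: "winv [] = []" "winv [x] = [linv x]" "winv (u @ v) = winv v @ winv u" "winv (winv u) = u"
  "length (winv u) = length u"
  by (simp_all add: winv_def rev_map comp_def)

lemma words_Cons [simp]: "x # w \<in> words S \<longleftrightarrow> x \<in> S \<times> UNIV \<and> w \<in> words S"
  by (auto simp: words_def)

lemma linv_in [simp]: "linv x \<in> S \<times> UNIV \<longleftrightarrow> x \<in> S \<times> UNIV"
  by (cases x) (simp add: linv_def)

lemma pres_eq_winv': "u \<in> words S \<Longrightarrow> pres_eq S R (u @ winv u) []"
  using pres_eq_winv[of "winv u" S R] by simp

lemma pres_eq_relator_split:
  assumes "u @ v \<in> R" "u @ v \<in> words S"
  shows "pres_eq S R u (winv v)"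
proof -
  have w: "u \<in> words S" "v \<in> words S" using assms by auto
  have "pres_eq S R (u @ (v @ winv v)) (u @ [])"
    by (intro pres_eq_append pres_eq.refl pres_eq_winv' w)
  moreover have "pres_eq S R ([] @ (u @ v) @ winv v) ([] @ winv v)"
    by (rule pres_eq.relator) (use assms w in auto)
  ultimately show ?thesis by (auto intro: pres_eq.intros)
qed

text \<open>Steps preserve the element of the group; conversely, free cancellation and relators are
  consequences of steps. So two words over the generators are equal in the group exactly when they
  are connected with some bound.\<close>

locale flip_presentation = flip_axis_system sw rd
  for sw :: "'a letter \<Rightarrow> 'a letter \<Rightarrow> 'a letter \<Rightarrow> 'a letter \<Rightarrow> bool" and rd :: "'a letter \<Rightarrow> 'a letter \<Rightarrow> 'a word \<Rightarrow> bool" +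
  fixes S :: "'a set" and R :: "'a word set"
  assumes finite_gens: "finite S"
    and sw_pres_eq: "sw a b c d \<Longrightarrow> [a, b] \<in> words S \<Longrightarrow> pres_eq S R [a, b] [c, d]"
    and rd_pres_eq: "rd a b z \<Longrightarrow> [a, b] \<in> words S \<Longrightarrow> pres_eq S R [a, b] z"
    and rd_linv: "rd x (linv x) []"
    and relator_conn: "r \<in> R \<Longrightarrow> \<exists>n. conn sw rd n r []"
begin

abbreviation "G \<equiv> presented_group S R"
abbreviation "X \<equiv> pres_X S R"
abbreviation "cls \<equiv> pres_class S R"
abbreviation "gl x \<equiv> cls [x]"
abbreviation "wl \<equiv> word_length G X"

sublocale G: group G by (rule group_presented_group)

lemma reach_pres_eq: "rch u v \<Longrightarrow> u \<in> words S \<Longrightarrow> pres_eq S R u v"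
proof (induction rule: reach.induct)
  case (reach_refl u)
  then show ?case by (rule pres_eq.refl)
next
  case (reach_swap u v w)
  then have uv: "pres_eq S R u v" by simp
  from reach_swap(2) show ?case
  proof cases
    case (1 a b c d p q)
    then have "p \<in> words S" "q \<in> words S" "[a, b] \<in> words S" using pres_eq_words[OF uv] by auto
    then have "pres_eq S R v w"
      unfolding 1 using 1(3) by (intro pres_eq_append_both sw_pres_eq)
    then show ?thesis using uv by (rule pres_eq.trans[rotated])
  qed
next
  case (reach_red u v w)
  then have uv: "pres_eq S R u v" by simp
  from reach_red(2) show ?case
  proof cases
    case (1 a b z p q)
    then have "p \<in> words S" "q \<in> words S" "[a, b] \<in> words S" using pres_eq_words[OF uv] by auto
    then have "pres_eq S R v w"
      unfolding 1 using 1(3) by (intro pres_eq_append_both rd_pres_eq)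
    then show ?thesis using uv by (rule pres_eq.trans[rotated])
  qed
qed

lemma pres_eq_conn: "pres_eq S R u v \<Longrightarrow> \<exists>n. cn n u v"
proof (induction rule: pres_eq.induct)
  case (refl u)
  then show ?case by (auto intro: conn_refl)
next
  case (sym u v)
  then show ?case by (auto intro: conn_sym)
next
  case (trans u v w)
  then obtain n m where "cn n u v" "cn m v w" by blast
  then have "cn (max n m) u v" "cn (max n m) v w" by (auto intro: conn_mono)
  then show ?case by (auto intro: conn_trans)
next
  case (cancel u v x)
  have "red1 rd (u @ [x, linv x] @ v) (u @ [] @ v)" by (intro red1.intros rd_linv)
  then show ?case using conn_red[OF _ order_refl] by fastforce
next
  case (relator u v r)
  then obtain n where "cn n r []" using relator_conn by blast
  then have "cn (n + length u + length v) (u @ r @ v) (u @ [] @ v)" by (rule conn_ctx) simp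
  then show ?case by auto
qed

section \<open>Word length in the presented group\<close>

lemma carrier_G: "carrier G = cls ` words S"
  by (simp add: presented_group_def)

lemma cls_carrier: "w \<in> words S \<Longrightarrow> cls w \<in> carrier G"
  by (simp add: carrier_G)

lemma cancel_left [simp]:
  assumes "a \<in> carrier G" "b \<in> carrier G"
  shows "inv\<^bsub>G\<^esub> a \<otimes>\<^bsub>G\<^esub> (a \<otimes>\<^bsub>G\<^esub> b) = b" "a \<otimes>\<^bsub>G\<^esub> (inv\<^bsub>G\<^esub> a \<otimes>\<^bsub>G\<^esub> b) = b"
  using assms by (simp_all flip: G.m_assoc)

lemma one_G: "\<one>\<^bsub>G\<^esub> = cls []"
  by (simp add: presented_group_def)

lemma inv_cls: "w \<in> words S \<Longrightarrow> inv\<^bsub>G\<^esub> (cls w) = cls (winv w)"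
  by (rule G.inv_equality) (auto simp: pres_class_mult carrier_G one_G pres_class_eq_iff pres_eq_winv)

lemma X_eq: "X = gl ` (S \<times> UNIV)"
proof -
  have "m_inv G ` pres_gen S R ` S = (\<lambda>s. gl (s, False)) ` S"
    unfolding image_image by (intro image_cong) (simp_all add: pres_gen_def inv_cls linv_def)
  moreover have "S \<times> (UNIV :: bool set) = (\<lambda>s. (s, True)) ` S \<union> (\<lambda>s. (s, False)) ` S"
    by (auto simp: image_iff)
  ultimately show ?thesis
    unfolding pres_X_def by (simp add: image_Un image_image pres_gen_def[abs_def])
qed

lemma word_value_gl: "w \<in> words S \<Longrightarrow> word_value G (map gl w) = cls w"
  by (induction w) (auto simp: word_value_def one_G pres_class_mult simp flip: one_G)

lemma lists_X: "lists X = map gl ` words S"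
  by (simp add: X_eq words_def lists_image)

lemma wl_le: "w \<in> words S \<Longrightarrow> wl (cls w) \<le> length w"
  unfolding word_length_def
  by (rule Least_le) (auto simp: lists_X word_value_gl intro!: bexI[of _ w])

lemma wl_witness:
  assumes "g \<in> carrier G" obtains w where "w \<in> words S" "g = cls w" "length w = wl g"
proof -
  obtain v where v: "v \<in> words S" "g = cls v" using assms by (auto simp: carrier_G)
  have "\<exists>xs\<in>lists X. length xs = wl g \<and> word_value G xs = g"
    unfolding word_length_def by (rule LeastI[of _ "length v"])
      (use v in \<open>auto simp: lists_X word_value_gl intro!: bexI[of _ v]\<close>)
  then show ?thesis using that by (auto simp: lists_X word_value_gl)
qed

lemma wl_mult: "a \<in> carrier G \<Longrightarrow> b \<in> carrier G \<Longrightarrow> wl (a \<otimes>\<^bsub>G\<^esub> b) \<le> wl a + wl b"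
  using wl_le by (elim wl_witness) (metis length_append pres_class_mult words_append)

lemma wl_inv_le: "a \<in> carrier G \<Longrightarrow> wl (inv\<^bsub>G\<^esub> a) \<le> wl a"
  using wl_le by (elim wl_witness) (metis inv_cls words_winv winv_simps(5))

lemma wl_inv: "a \<in> carrier G \<Longrightarrow> wl (inv\<^bsub>G\<^esub> a) = wl a"
  using wl_inv_le[of a] wl_inv_le[of "inv\<^bsub>G\<^esub> a"] by simp

text \<open>Every other word for the same element is connected to \<open>w\<close>, so
  \<open>irreducible_minimal\<close> bounds its length from below; conversely the result of a strip
  is shorter.\<close>

lemma wl_irreducible:
  assumes "w \<in> words S"
  shows "wl (cls w) = length w \<longleftrightarrow> irreducible sw rd w"
proof
  assume irr: "irreducible sw rd w"
  have "cls w \<in> carrier G" using assms by (simp add: carrier_G)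
  then obtain v where v: "v \<in> words S" "cls w = cls v" "length v = wl (cls w)" by (rule wl_witness)
  then obtain n where "cn n w v" using pres_class_eq_iff[OF assms] pres_eq_conn by blast
  then have "length w \<le> length v" using irreducible_minimal[OF irr] by blast
  then show "wl (cls w) = length w" using v wl_le[OF assms] by simp
next
  assume l: "wl (cls w) = length w"
  show "irreducible sw rd w" unfolding irreducible_def
  proof
    assume "\<exists>r. pat sw rd w r"
    then obtain r where r: "pat sw rd w r" by blast
    then have "pres_eq S R w r" using reach_pres_eq[OF pat_reach[OF r] assms] by blast
    then have "r \<in> words S" "cls w = cls r" using pres_eq_words pres_class_eq_iff[OF assms] by blast+
    then show False using wl_le[of r] pat_length[OF r] l by simp
  qed
qed

lemma regular_geodesics: "regular_language X (geodesic_words G X)"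
proof -
  have "geodesic_words G X = map gl ` {w \<in> words S. irreducible sw rd w}"
    by (auto simp: geodesic_words_def lists_X word_value_gl wl_irreducible)
  moreover have "regular_language (gl ` (S \<times> UNIV)) (map gl ` {w \<in> lists (S \<times> UNIV). irreducible sw rd w})"
  proof (rule regular_irreducible)
    show "finite (S \<times> (UNIV :: bool set))" using finite_gens by simp
    show "inj_on gl (S \<times> UNIV)"
    proof (rule inj_onI)
      fix x y assume "x \<in> S \<times> (UNIV :: bool set)" "y \<in> S \<times> (UNIV :: bool set)" "gl x = gl y"
      then have "pres_eq S R [x] [y]" by (simp add: pres_class_eq_iff)
      then show "x = y" using pres_eq_conn conn_single by blast
    qed
    show "a' \<in> S \<times> (UNIV :: bool set)"
      if "a \<in> S \<times> (UNIV :: bool set)" "b \<in> S \<times> (UNIV :: bool set)" "sw a b b' a'" for a b b' a'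
      using pres_eq_words[OF sw_pres_eq[OF that(3)]] that by simp
  qed
  ultimately show ?thesis by (simp add: X_eq words_def)
qed

section \<open>Powers, conjugates and translation length\<close>

lemma pow_cls: "w \<in> words S \<Longrightarrow> cls w [^]\<^bsub>G\<^esub> (n::nat) = cls (concat (replicate n w)) \<and> concat (replicate n w) \<in> words S"
proof (induction n)
  case (Suc n)
  have "concat (replicate n w) @ w = w @ concat (replicate n w)"
    by (induction n) auto
  with Suc show ?case by (simp add: pres_class_mult)
qed (simp add: one_G)

lemma conj_pow:
  assumes "k \<in> carrier G" "g \<in> carrier G"
  shows "(k \<otimes>\<^bsub>G\<^esub> g \<otimes>\<^bsub>G\<^esub> inv\<^bsub>G\<^esub> k) [^]\<^bsub>G\<^esub> (n::nat) = k \<otimes>\<^bsub>G\<^esub> g [^]\<^bsub>G\<^esub> n \<otimes>\<^bsub>G\<^esub> inv\<^bsub>G\<^esub> k"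
proof (induction n)
  case (Suc n)
  with assms show ?case by (simp add: G.m_assoc)
qed (use assms in simp)

lemma square_axis:
  assumes "g \<in> carrier G"
  obtains k u where "k \<in> carrier G" "u \<in> words S"
    "cls u = k \<otimes>\<^bsub>G\<^esub> g [^]\<^bsub>G\<^esub> (2::nat) \<otimes>\<^bsub>G\<^esub> inv\<^bsub>G\<^esub> k"
    "\<And>n::nat. wl (cls u [^]\<^bsub>G\<^esub> n) = n * length u"
proof -
  define M where "M = {w \<in> words S. \<exists>k\<in>carrier G. cls w = k \<otimes>\<^bsub>G\<^esub> g \<otimes>\<^bsub>G\<^esub> inv\<^bsub>G\<^esub> k}"
  obtain v0 where v0: "v0 \<in> words S" "g = cls v0" using assms by (auto simp: carrier_G)
  then have "v0 \<in> M" using assms by (auto simp: M_def intro!: bexI[of _ "\<one>\<^bsub>G\<^esub>"])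
  then obtain v where v: "v \<in> M" "\<And>w. w \<in> M \<Longrightarrow> length v \<le> length w"
    using ex_has_least_nat[of "\<lambda>w. w \<in> M" v0 length] by blast
  have "\<exists>x\<in>M. \<exists>u. rch (x @ x) u \<and> (\<forall>n. irreducible sw rd (concat (replicate n u)))"
  proof (rule irreducible_axis)
    fix u w assume "u \<in> M" "rch u w"
    then show "w \<in> M"
      unfolding M_def using reach_pres_eq[of u w] pres_eq_words[of S R u w] pres_class_eq_iff[of u S R w] by auto
  next
    fix p q assume "p @ q \<in> M"
    then obtain k where k: "p \<in> words S" "q \<in> words S" "k \<in> carrier G"
      "cls (p @ q) = k \<otimes>\<^bsub>G\<^esub> g \<otimes>\<^bsub>G\<^esub> inv\<^bsub>G\<^esub> k" by (auto simp: M_def)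
    have c: "cls p \<in> carrier G" "cls q \<in> carrier G" using k by (auto simp: carrier_G)
    have "cls (q @ p) = inv\<^bsub>G\<^esub> (cls p) \<otimes>\<^bsub>G\<^esub> cls (p @ q) \<otimes>\<^bsub>G\<^esub> cls p"
      using c k(1,2) by (simp add: G.m_assoc flip: pres_class_mult)
    also have "\<dots> = (inv\<^bsub>G\<^esub> (cls p) \<otimes>\<^bsub>G\<^esub> k) \<otimes>\<^bsub>G\<^esub> g \<otimes>\<^bsub>G\<^esub> inv\<^bsub>G\<^esub> (inv\<^bsub>G\<^esub> (cls p) \<otimes>\<^bsub>G\<^esub> k)"
      unfolding k(4) using c k(3) assms by (simp add: G.m_assoc G.inv_mult_group)
    finally show "q @ p \<in> M" using c k by (auto simp: M_def)
  qed (use v in auto)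
  then obtain x u where x: "x \<in> M" "rch (x @ x) u" and irr: "\<And>n. irreducible sw rd (concat (replicate n u))"
    by blast
  then obtain k where k: "x \<in> words S" "k \<in> carrier G" "cls x = k \<otimes>\<^bsub>G\<^esub> g \<otimes>\<^bsub>G\<^esub> inv\<^bsub>G\<^esub> k"
    by (auto simp: M_def)
  have xu: "pres_eq S R (x @ x) u" using reach_pres_eq[OF x(2)] k by simp
  then have u: "u \<in> words S" using pres_eq_words by blast
  have "cls u = cls x [^]\<^bsub>G\<^esub> (2::nat)"
    using pres_class_eq_iff[of "x @ x" S R u] xu k(1) pow_cls[OF k(1), of 2] by (simp add: numeral_2_eq_2)
  also have "\<dots> = k \<otimes>\<^bsub>G\<^esub> g [^]\<^bsub>G\<^esub> (2::nat) \<otimes>\<^bsub>G\<^esub> inv\<^bsub>G\<^esub> k"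
    unfolding k(3) by (rule conj_pow) (use k assms in auto)
  finally have "cls u = k \<otimes>\<^bsub>G\<^esub> g [^]\<^bsub>G\<^esub> (2::nat) \<otimes>\<^bsub>G\<^esub> inv\<^bsub>G\<^esub> k" .
  moreover have "wl (cls u [^]\<^bsub>G\<^esub> n) = n * length u" for n :: nat
    using pow_cls[OF u, of n] wl_irreducible[of "concat (replicate n u)"] irr[of n] by simp
  ultimately show thesis using that k u by blast
qed

lemma square_conjugate_periodically_geodesic:
  assumes "g \<in> carrier G"
  shows "\<exists>h\<in>carrier G. conjugate_in G (g [^]\<^bsub>G\<^esub> (2::nat)) h \<and> periodically_geodesic G X h"
proof -
  obtain k u where k: "k \<in> carrier G" "u \<in> words S"
    "cls u = k \<otimes>\<^bsub>G\<^esub> g [^]\<^bsub>G\<^esub> (2::nat) \<otimes>\<^bsub>G\<^esub> inv\<^bsub>G\<^esub> k"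
    and l: "\<And>n::nat. wl (cls u [^]\<^bsub>G\<^esub> n) = n * length u"
    using square_axis[OF assms] by metis
  have u: "cls u \<in> carrier G" using k cls_carrier by blast
  then have l1: "wl (cls u) = length u" using l[of 1] by simp
  have "int (wl (cls u [^]\<^bsub>G\<^esub> n)) = \<bar>n\<bar> * int (wl (cls u))" for n :: int
  proof (cases n)
    case (nonneg m)
    then show ?thesis using l[of m] l1 by (simp add: int_pow_int)
  next
    case (neg m)
    then show ?thesis using l[of "Suc m"] l1 u wl_inv[of "cls u [^]\<^bsub>G\<^esub> Suc m"]
      by (simp add: G.int_pow_neg_int del: G.nat_pow_Suc nat_pow_Suc of_nat_Suc) (simp add: algebra_simps)
  qed
  then show ?thesis using k u unfolding periodically_geodesic_def conjugate_in_def by blast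
qed

lemma translation_length_half_integral:
  assumes "g \<in> carrier G"
  shows "\<exists>m::nat. translation_length G X g = real m / 2"
proof -
  obtain k u where k: "k \<in> carrier G" "u \<in> words S"
    "cls u = k \<otimes>\<^bsub>G\<^esub> g [^]\<^bsub>G\<^esub> (2::nat) \<otimes>\<^bsub>G\<^esub> inv\<^bsub>G\<^esub> k"
    and l: "\<And>n::nat. wl (cls u [^]\<^bsub>G\<^esub> n) = n * length u"
    using square_axis[OF assms] by metis
  \<comment> \<open>Conjugation by \<open>k\<close> changes the length by at most
    \<open>2 * wl k\<close>, and a factor \<open>g\<close> for odd exponents by at most
    \<open>wl g\<close>. The further summand \<open>length u\<close> in \<open>bound\<close> absorbs
    the rounding in \<open>N div 2\<close>.\<close>
  define C where "C = 2 * wl k + wl g"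
  have bound: "\<bar>real (wl (g [^]\<^bsub>G\<^esub> N)) - real N * (real (length u) / 2)\<bar> \<le> C + length u" for N :: nat
  proof -
    define n where "n = N div 2"
    define e where "e = g [^]\<^bsub>G\<^esub> (N mod 2)"
    define h where "h = cls u [^]\<^bsub>G\<^esub> n"
    define a where "a = g [^]\<^bsub>G\<^esub> (2 * n)"
    have c: "e \<in> carrier G" "a \<in> carrier G" "h \<in> carrier G"
      using assms k cls_carrier[OF k(2)] by (auto simp: e_def a_def h_def)
    have N: "g [^]\<^bsub>G\<^esub> N = a \<otimes>\<^bsub>G\<^esub> e"
      unfolding a_def e_def n_def using assms by (simp add: G.nat_pow_mult)
    have h: "h = k \<otimes>\<^bsub>G\<^esub> a \<otimes>\<^bsub>G\<^esub> inv\<^bsub>G\<^esub> k"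
      unfolding h_def k(3) a_def using assms k by (subst conj_pow) (auto simp: G.nat_pow_pow)
    have a: "a = inv\<^bsub>G\<^esub> k \<otimes>\<^bsub>G\<^esub> h \<otimes>\<^bsub>G\<^esub> k"
      unfolding h using k c by (simp add: G.m_assoc)
    have aN: "a = g [^]\<^bsub>G\<^esub> N \<otimes>\<^bsub>G\<^esub> inv\<^bsub>G\<^esub> e"
      unfolding N using c by (simp add: G.m_assoc)
    have e: "wl e \<le> wl g"
    proof (cases "N mod 2 = 0")
      case True
      then show ?thesis using wl_le[of "[]"] by (simp add: e_def one_G)
    next
      case False
      then show ?thesis using assms by (simp add: e_def)
    qed
    have "wl (g [^]\<^bsub>G\<^esub> N) \<le> wl h + C"
    proof -
      have "wl (g [^]\<^bsub>G\<^esub> N) \<le> wl a + wl e" unfolding N using c by (intro wl_mult)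
      moreover have "wl a \<le> wl (inv\<^bsub>G\<^esub> k \<otimes>\<^bsub>G\<^esub> h) + wl k" unfolding a using c k by (intro wl_mult) auto
      moreover have "wl (inv\<^bsub>G\<^esub> k \<otimes>\<^bsub>G\<^esub> h) \<le> wl (inv\<^bsub>G\<^esub> k) + wl h" using c k by (intro wl_mult) auto
      ultimately show ?thesis using e wl_inv[OF k(1)] by (simp add: C_def)
    qed
    moreover have "wl h \<le> wl (g [^]\<^bsub>G\<^esub> N) + C"
    proof -
      have "wl h \<le> wl (k \<otimes>\<^bsub>G\<^esub> a) + wl (inv\<^bsub>G\<^esub> k)" unfolding h using c k by (intro wl_mult) auto
      moreover have "wl (k \<otimes>\<^bsub>G\<^esub> a) \<le> wl k + wl a" using c k by (intro wl_mult)
      moreover have "wl a \<le> wl (g [^]\<^bsub>G\<^esub> N) + wl (inv\<^bsub>G\<^esub> e)"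
        by (subst aN, rule wl_mult) (use c assms in auto)
      ultimately show ?thesis using e wl_inv[OF k(1)] wl_inv[OF c(1)] by (simp add: C_def)
    qed
    moreover have "wl h = n * length u" unfolding h_def by (rule l)
    moreover have "real N = 2 * real n + real (N mod 2)" unfolding n_def
      by (metis mult_div_mod_eq of_nat_add of_nat_mult of_nat_numeral)
    then have "real N * (real (length u) / 2) = real (n * length u) + real (N mod 2) * (real (length u) / 2)"
      by (simp add: algebra_simps)
    moreover have "real (N mod 2) * (real (length u) / 2) \<le> length u"
      by (cases "N mod 2 = 0") auto
    moreover have "real (N mod 2) * (real (length u) / 2) \<ge> 0" by simp
    ultimately show ?thesis by linarith
  qed
  have "(\<lambda>N. real (wl (g [^]\<^bsub>G\<^esub> N)) / real N - real (length u) / 2) \<longlonglongrightarrow> 0"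
  proof (rule tendsto_0_le[where K = 1])
    show "(\<lambda>N. real (C + length u) / real N) \<longlonglongrightarrow> 0" by (rule lim_const_over_n)
    show "\<forall>\<^sub>F N in sequentially. norm (real (wl (g [^]\<^bsub>G\<^esub> N)) / real N - real (length u) / 2) \<le> norm (real (C + length u) / real N) * 1"
    proof (rule eventually_sequentiallyI[of 1])
      fix N :: nat assume "1 \<le> N"
      then have "real (wl (g [^]\<^bsub>G\<^esub> N)) / real N - real (length u) / 2 =
          (real (wl (g [^]\<^bsub>G\<^esub> N)) - real N * (real (length u) / 2)) / real N"
        by (simp add: field_simps)
      then show "norm (real (wl (g [^]\<^bsub>G\<^esub> N)) / real N - real (length u) / 2) \<le> norm (real (C + length u) / real N) * 1"
        using bound[of N] by (simp add: divide_right_mono)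
    qed
  qed
  then have "(\<lambda>N. real (wl (g [^]\<^bsub>G\<^esub> N)) / real N) \<longlonglongrightarrow> real (length u) / 2"
    using LIM_zero_iff by blast
  then show ?thesis unfolding translation_length_def using limI by blast
qed

end

section \<open>Small cancellation presentations\<close>

lemma reduced_no_cancel:
  assumes "reduced (u @ v)" "u \<noteq> []" "v \<noteq> []" shows "hd v \<noteq> linv (last u)"
proof -
  have "Suc (length u - 1) < length (u @ v)" using assms by (cases u; cases v) auto
  with assms(1) have "(u @ v) ! Suc (length u - 1) \<noteq> linv ((u @ v) ! (length u - 1))"
    unfolding reduced_def by blast
  then show ?thesis using assms(2,3) by (simp add: nth_append hd_conv_nth last_conv_nth)
qed

text \<open>A relator is an edge of the link from its first letter to the inverse of its last one.
  So \<open>link\<close> makes a closed path of relators with a cancellation at every junction, and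
  \<open>nb\<close> excludes backtracking, that is, a relator followed by its inverse. This
  contradicts condition T.\<close>

lemma cond_T_no_cycle:
  assumes T: "cond_T R q" and len: "length rs = k" and k: "3 \<le> k" "k < q" and R: "set rs \<subseteq> R" "[] \<notin> R"
    and link: "\<And>i. i < k \<Longrightarrow> hd (rs ! (Suc i mod k)) = linv (last (rs ! i))"
    and nb: "\<And>i. i < k \<Longrightarrow> hd (rs ! i) \<noteq> hd (rs ! (Suc (Suc i mod k) mod k))"
  shows False
proof -
  have m: "i mod k < k" for i using k(1) by (intro mod_less_divisor) simp
  have in_R: "rs ! i \<in> R" if "i < k" for i using that len R nth_mem[of i rs] by blast
  have ne: "rs ! i \<noteq> []" if "i < k" for i using in_R[OF that] R by metis
  have neq: "rs ! i \<noteq> winv (rs ! (Suc i mod k))" if "i < k" for i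
  proof -
    let ?r = "rs ! (Suc i mod k)"
    have "hd (winv ?r) = linv (last ?r)" using ne[OF m[of "Suc i"]] by (simp add: winv_def hd_rev last_map)
    then show ?thesis using nb[OF that] link[OF m[of "Suc i"]] by metis
  qed
  have "\<exists>i<k. reduced (rs ! i @ rs ! (Suc i mod k))"
    using T[unfolded cond_T_def, rule_format, of k "\<lambda>i. rs ! i"] k in_R neq by blast
  then obtain i where i: "i < k" "reduced (rs ! i @ rs ! (Suc i mod k))" by blast
  then show False using reduced_no_cancel[OF i(2) ne[OF i(1)] ne[OF m]] link[OF i(1)] by simp
qed

lemma less_numeral_cases:
  "i < (3::nat) \<Longrightarrow> i = 0 \<or> i = 1 \<or> i = 2"
  "i < (4::nat) \<Longrightarrow> i = 0 \<or> i = 1 \<or> i = 2 \<or> i = 3"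
  "i < (5::nat) \<Longrightarrow> i = 0 \<or> i = 1 \<or> i = 2 \<or> i = 3 \<or> i = 4"
  by auto

lemma presentation_facts:
  assumes "finite_symmetrized_presentation S R" "r \<in> R"
  shows "rotate k r \<in> R" "winv r \<in> R" "r \<in> words S" "r \<noteq> []" "cyclically_reduced r"
  using assms unfolding finite_symmetrized_presentation_def by blast+

text \<open>A common prefix \<open>[a, b]\<close> of different relators would be a piece of length
  two.\<close>

lemma cond_P_unique:
  assumes "cond_P R" "a # b # u \<in> R" "a # b # v \<in> R" shows "u = v"
proof (rule ccontr)
  assume "u \<noteq> v"
  then have "piece R [a, b]" unfolding piece_def
    using assms(2,3) by (intro conjI bexI[of _ "a # b # u"] bexI[of _ "a # b # v"]) auto
  then show False using assms(1) unfolding cond_P_def by fastforce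
qed

lemma cyclically_reduced_head: "cyclically_reduced (a # b # u) \<Longrightarrow> b \<noteq> linv a"
  unfolding cyclically_reduced_def reduced_def by force

section \<open>From presentations to square and triangle complexes\<close>

lemma squares_presentation:
  assumes pr: "finite_symmetrized_presentation S R" and c: "cond_C''_T R 4 4"
  shows "squares (\<lambda>a b c d. [a, b, c, d] \<in> R)"
proof
  note f = presentation_facts[OF pr]
  have P: "cond_P R" and T: "cond_T R 4" using c by (auto simp: cond_C''_T_def cond_C''_def)
  have ne: "[] \<notin> R" using f(4) by blast
  show rot: "[b, c, d, a] \<in> R" if "[a, b, c, d] \<in> R" for a b c d
    using f(1)[OF that, of 1] by simp
  show "[linv d, linv c, linv b, linv a] \<in> R" if "[a, b, c, d] \<in> R" for a b c d
    using f(2)[OF that] by (simp add: winv_def)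
  show nc: "b \<noteq> linv a" if "[a, b, c, d] \<in> R" for a b c d
    using cyclically_reduced_head[OF f(5)[OF that]] .
  show "c' = c \<and> d' = d" if "[a, b, c, d] \<in> R" "[a, b, c', d'] \<in> R" for a b c d c' d'
    using cond_P_unique[OF P that] by simp
  show "[a, b, a, b] \<notin> R" for a b
  proof
    assume "[a, b, a, b] \<in> R"
    moreover have "proper_power [a, b, a, b]"
      unfolding proper_power_def by (intro exI[of _ "[a, b]"] exI[of _ 2]) (simp add: numeral_2_eq_2)
    ultimately show False using P by (simp add: cond_P_def)
  qed
  show "[linv z, x, c3, d3] \<notin> R" if "[linv x, y, c1, d1] \<in> R" "[linv y, z, c2, d2] \<in> R"
    for x y z c1 d1 c2 d2 c3 d3
  proof
    assume h: "[linv z, x, c3, d3] \<in> R"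
    \<comment> \<open>The relators are rotated so that each starts at a vertex of the link and ends
      in the inverse of the next one.\<close>
    let ?rs = "[[y, c1, d1, linv x], [x, c3, d3, linv z], [z, c2, d2, linv y]]"
    have s: "set ?rs \<subseteq> R" using rot that h by simp
    have n: "y \<noteq> x" "z \<noteq> y" "x \<noteq> z" using nc[OF that(1)] nc[OF that(2)] nc[OF h] by auto
    show False
      by (rule cond_T_no_cycle[OF T _ _ _ s ne, of 3]) (use n in \<open>auto dest!: less_numeral_cases\<close>)
  qed
qed

lemma triangles_presentation:
  assumes pr: "finite_symmetrized_presentation S R" and c: "cond_C''_T R 3 6"
  shows "triangles (\<lambda>a b c. [a, b, linv c] \<in> R)"
proof
  note f = presentation_facts[OF pr]
  have P: "cond_P R" and T: "cond_T R 6" using c by (auto simp: cond_C''_T_def cond_C''_def)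
  have ne: "[] \<notin> R" using f(4) by blast
  have rot: "[b, c, a] \<in> R" if "[a, b, c] \<in> R" for a b c
    using f(1)[OF that, of 1] by simp
  have inv: "[linv c, linv b, linv a] \<in> R" if "[a, b, c] \<in> R" for a b c
    using f(2)[OF that] by (simp add: winv_def)
  show "[linv a, c, linv b] \<in> R" if "[a, b, linv c] \<in> R" for a b c
    using rot[OF rot[OF inv[OF that]]] by simp
  show "[c, linv b, linv a] \<in> R" if "[a, b, linv c] \<in> R" for a b c
    using inv[OF that] by simp
  show nc: "b \<noteq> linv a" if "[a, b, linv c] \<in> R" for a b c
    using cyclically_reduced_head[OF f(5)[OF that]] .
  show "c' = c" if "[a, b, linv c] \<in> R" "[a, b, linv c'] \<in> R" for a b c c'
    using cond_P_unique[OF P that] by simp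
  show "[a, a, linv (linv a)] \<notin> R" for a
  proof
    assume "[a, a, linv (linv a)] \<in> R"
    moreover have "proper_power [a, a, a]"
      unfolding proper_power_def by (intro exI[of _ "[a]"] exI[of _ 3]) (simp add: numeral_3_eq_3)
    ultimately show False using P by (simp add: cond_P_def)
  qed
  have e: "[y, linv c, linv x] \<in> R" if "[linv x, y, linv c] \<in> R" for x y c
    using rot[OF that] .
  show l3: "[linv z, x, linv c3] \<notin> R" if h: "[linv x, y, linv c1] \<in> R" "[linv y, z, linv c2] \<in> R"
    for x y z c1 c2 c3
  proof
    assume h': "[linv z, x, linv c3] \<in> R"
    let ?rs = "[[y, linv c1, linv x], [x, linv c3, linv z], [z, linv c2, linv y]]"
    have s: "set ?rs \<subseteq> R" using e h h' by simp
    have n: "y \<noteq> x" "z \<noteq> y" "x \<noteq> z" using nc[OF h(1)] nc[OF h(2)] nc[OF h'] by auto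
    show False
      by (rule cond_T_no_cycle[OF T _ _ _ s ne, of 3]) (use n in \<open>auto dest!: less_numeral_cases\<close>)
  qed
  show "x = z \<or> y = w" if h: "[linv x, y, linv c1] \<in> R" "[linv y, z, linv c2] \<in> R"
    "[linv z, w, linv c3] \<in> R" "[linv w, x, linv c4] \<in> R" for x y z w c1 c2 c3 c4
  proof (rule ccontr)
    assume n: "\<not> (x = z \<or> y = w)"
    let ?rs = "[[y, linv c1, linv x], [x, linv c4, linv w], [w, linv c3, linv z], [z, linv c2, linv y]]"
    have s: "set ?rs \<subseteq> R" using e h by simp
    show False
      by (rule cond_T_no_cycle[OF T _ _ _ s ne, of 4]) (use n in \<open>auto dest!: less_numeral_cases\<close>)
  qed
  show "[linv v, x, linv c5] \<notin> R" if h: "[linv x, y, linv c1] \<in> R" "[linv y, z, linv c2] \<in> R"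
    "[linv z, w, linv c3] \<in> R" "[linv w, v, linv c4] \<in> R" for x y z w v c1 c2 c3 c4 c5
  proof
    assume h': "[linv v, x, linv c5] \<in> R"
    \<comment> \<open>If two vertices two apart on the cycle coincided, the other three edges would
      form a triangle.\<close>
    have n: "x \<noteq> z" "y \<noteq> w" "z \<noteq> v" "w \<noteq> x" "v \<noteq> y"
      using l3 h h' by metis+
    let ?rs = "[[y, linv c1, linv x], [x, linv c5, linv v], [v, linv c4, linv w], [w, linv c3, linv z], [z, linv c2, linv y]]"
    have s: "set ?rs \<subseteq> R" using e h h' by simp
    show False
      by (rule cond_T_no_cycle[OF T _ _ _ s ne, of 5]) (use n in \<open>auto dest!: less_numeral_cases\<close>)
  qed
qed

lemma flip_presentation_squares:
  assumes pr: "finite_symmetrized_presentation S R" and c: "cond_C''_T R 4 4"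
  shows "\<exists>sw rd. flip_presentation sw rd S R"
proof -
  interpret squares "\<lambda>a b c d. [a, b, c, d] \<in> R" using squares_presentation[OF assms] .
  have "flip_presentation sw rd S R"
  proof
    show "finite S" using pr by (simp add: finite_symmetrized_presentation_def)
    show "pres_eq S R [a, b] [c, d]" if "sw a b c d" "[a, b] \<in> words S" for a b c d
    proof -
      have r: "[a, b] @ [linv d, linv c] \<in> R" using that by (simp add: sw_def)
      from pres_eq_relator_split[OF r presentation_facts(3)[OF pr r]] show ?thesis
        by (simp add: winv_def)
    qed
    show "pres_eq S R [a, b] z" if "rd a b z" "[a, b] \<in> words S" for a b z
      using that pres_eq_winv'[of "[a]" S R] by (simp add: rd_def)
    show "rd x (linv x) []" for x by (simp add: rd_def)
    show "\<exists>n. conn sw rd n r []" if r: "r \<in> R" for r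
    proof -
      have "length r = 4" using c r by (simp add: cond_C''_T_def cond_C''_def)
      then obtain a b c d where abcd: "r = [a, b, c, d]"
        by (auto simp: numeral_eq_Suc length_Suc_conv)
      then have "sw a b (linv d) (linv c)" using r by (simp add: sw_def)
      \<comment> \<open>Flipping the first half of the relator gives the inverse of the second half,
        which then cancels.\<close>
      then have "swap1 sw ([] @ [a, b] @ [c, d]) ([] @ [linv d, linv c] @ [c, d])" by (rule swap1.intros)
      moreover have "red1 rd ([linv d] @ [linv c, c] @ [d]) ([linv d] @ [] @ [d])"
        by (rule red1.intros) (simp add: rd_def)
      moreover have "red1 rd ([] @ [linv d, d] @ []) ([] @ [] @ [])"
        by (rule red1.intros) (simp add: rd_def)
      ultimately have "reach sw rd r []" unfolding abcd
        by (auto intro: reach_red[OF reach_red[OF reach_swap[OF reach_refl]]])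
      then show ?thesis using reach_conn by blast
    qed
  qed
  then show ?thesis by blast
qed

lemma flip_presentation_triangles:
  assumes pr: "finite_symmetrized_presentation S R" and c: "cond_C''_T R 3 6"
  shows "\<exists>sw rd. flip_presentation sw rd S R"
proof -
  interpret triangles "\<lambda>a b c. [a, b, linv c] \<in> R" using triangles_presentation[OF assms] .
  have tr: "pres_eq S R [a, b] [c]" if "[a, b, linv c] \<in> R" for a b c
    using pres_eq_relator_split[of "[a, b]" "[linv c]" R S] presentation_facts(3)[OF pr that] that by simp
  have "flip_presentation sw rd S R"
  proof
    show "finite S" using pr by (simp add: finite_symmetrized_presentation_def)
    show "pres_eq S R [a, b] [c, d]" if H: "sw a b c d" for a b c d
    proof -
      obtain t where t: "[a, t, linv c] \<in> R" "[t, d, linv b] \<in> R" using H unfolding sw_def by blast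
      \<comment> \<open>Both sides of the flip equal \<open>a t d\<close>, the path across the edge
        shared by the two triangles.\<close>
      have "pres_eq S R ([a] @ [b]) ([a] @ [t, d])"
        using tr[OF t(2)] presentation_facts(3)[OF pr t(1)] by (intro pres_eq_append) (auto intro: pres_eq.intros)
      moreover have "pres_eq S R ([a, t] @ [d]) ([c] @ [d])"
        using tr[OF t(1)] presentation_facts(3)[OF pr t(2)] by (intro pres_eq_append) (auto intro: pres_eq.intros)
      ultimately show ?thesis by (auto intro: pres_eq.trans)
    qed
    show "pres_eq S R [a, b] z" if "rd a b z" "[a, b] \<in> words S" for a b z
      using that tr pres_eq_winv'[of "[a]" S R] by (auto simp: rd_def)
    show "rd x (linv x) []" for x by (simp add: rd_def)
    show "\<exists>n. conn sw rd n r []" if r: "r \<in> R" for r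
    proof -
      have "length r = 3" using c r by (simp add: cond_C''_T_def cond_C''_def)
      then obtain a b c where abc: "r = [a, b, c]"
        by (auto simp: numeral_eq_Suc length_Suc_conv)
      then have "rd a b [linv c]" using r by (simp add: rd_def)
      then have "red1 rd ([] @ [a, b] @ [c]) ([] @ [linv c] @ [c])" by (rule red1.intros)
      moreover have "red1 rd ([] @ [linv c, c] @ []) ([] @ [] @ [])"
        by (rule red1.intros) (simp add: rd_def)
      ultimately have "reach sw rd r []" unfolding abc
        by (auto intro: reach_red[OF reach_red[OF reach_refl]])
      then show ?thesis using reach_conn by blast
    qed
  qed
  then show ?thesis by blast
qed

theorem theorem0p7:
  fixes S :: "'a set" and R :: "'a word set"
  defines "G \<equiv> presented_group S R" and "X \<equiv> pres_X S R"
  assumes "finite_symmetrized_presentation S R"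
    and "cond_C''_T R 4 4 \<or> cond_C''_T R 3 6"
  shows "(\<forall>g\<in>carrier G. translation_length G X g \<in> \<rat> \<and> 2 * translation_length G X g \<in> \<int>) \<and>
    (\<forall>g\<in>carrier G. g \<noteq> \<one>\<^bsub>G\<^esub> \<longrightarrow>
       (\<exists>h\<in>carrier G. conjugate_in G (g [^]\<^bsub>G\<^esub> (2::nat)) h \<and> periodically_geodesic G X h)) \<and>
    regular_language X (geodesic_words G X)"
proof -
  obtain sw rd where "flip_presentation sw rd S R"
    using assms flip_presentation_squares flip_presentation_triangles by blast
  then interpret flip_presentation sw rd S R .
  have "translation_length G X g \<in> \<rat> \<and> 2 * translation_length G X g \<in> \<int>" if g: "g \<in> carrier G" for g
  proof -
    obtain m :: nat where "translation_length G X g = real m / 2"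
      using translation_length_half_integral g unfolding G_def X_def by blast
    then show ?thesis by (simp only:) simp
  qed
  then show ?thesis
    using square_conjugate_periodically_geodesic regular_geodesics unfolding G_def X_def by blast
qed

end
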